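(* Under the Continuum Hypothesis, each compact Hausdorff space of weight $\le\omega_1$ is homeomorphic to the Higson corona of some cellular finitary coarse space $(X,\mathcal E)$ with $|X|=\omega$.
   Context: An entourage on a set $X$ is a subset $E\subseteq X\times X$ containing the diagonal $\Delta_X$; $E^{-1}=\{(y,x):(x,y)\in E\}$, $E\circ F=\{(x,z):\exists y\in X,\ (x,y)\in E,\ (y,z)\in F\}$, $E[x]=\{y\in X:(x,y)\in E\}$. A coarse space $(X,\mathcal E)$ is a set $X$ with a family $\mathcal E$ of entourages (its coarse structure) such that $\bigcup\mathcal E=X\times X$; for all $E,F\in\mathcal E$ there is $G\in\mathcal E$ with $E\circ F^{-1}\subseteq G$; and $\Delta_X\subseteq E\subseteq F\in\mathcal E$ implies $E\in\mathcal E$. A set $B\subseteq X$ is bounded if $B\subseteq E[x]$ for some $E\in\mathcal E$, $x\in X$. The coarse space is finitary if $\sup_{x\in X}|E[x]|$ is finite for every $E\in\mathcal E$, and cellular if each $E\in\mathcal E$ is contained in some $B\in\mathcal E$ that is an equivalence relation. A function $\varphi:X\to\mathbb R$ is slowly oscillating if for every $\varepsilon>0$ and $E\in\mathcal E$ there is a bounded set $B\subseteq X$ with $\mathrm{diam}\,\varphi(E[x])<\varepsilon$ for all $x\in X\setminus B$. Let $\mathsf{so}(X,\mathcal E;\mathbb R)$ be the set of all bounded slowly oscillating functions $X\to\mathbb R$. The Higson compactification $h_{\mathbb R}(X,\mathcal E)$ is the closure of the image of the injective map $X\to\mathbb R^{\mathsf{so}(X,\mathcal E;\mathbb R)}$,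 $x\mapsto(f(x))_f$ (product topology); $X$ is identified with its image. The Higson corona of $(X,\mathcal E)$ is $h_{\mathbb R}(X,\mathcal E)\setminus\bigcup\{\bar B:B\subseteq X\text{ bounded}\}$ (closures in $h_{\mathbb R}(X,\mathcal E)$); for a finitary coarse space it equals $h_{\mathbb R}(X,\mathcal E)\setminus X$.
   Formalization: The compact Hausdorff space is assumed nonempty; for the empty space the claim fails, since the Higson corona of a finitary coarse space on a countably infinite set is never empty. *)

theory Defs
  imports "HOL-Analysis.Analysis"
begin

unbundle cardinal_syntax

section \<open>The Continuum Hypothesis and the weight of a topological space\<close>

text \<open>\<^term>\<open>natLeq\<close> is the cardinal \<open>\<omega>\<close>; its successor cardinal is \<open>\<omega>\<^sub>1\<close>.\<close>

abbreviation omega1 :: "nat set rel"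
  where "omega1 \<equiv> cardSuc natLeq"

definition continuum_hypothesis :: bool
  where "continuum_hypothesis \<longleftrightarrow> |UNIV :: real set| =o omega1"

definition is_base :: "'a topology \<Rightarrow> 'a set set \<Rightarrow> bool"
  where "is_base T \<B> \<longleftrightarrow>
    (\<forall>V\<in>\<B>. openin T V) \<and>
    (\<forall>U x. openin T U \<and> x \<in> U \<longrightarrow> (\<exists>V\<in>\<B>. x \<in> V \<and> V \<subseteq> U))"

text \<open>The weight is the cardinality of a base of least cardinality; such a base exists
  because cardinals are well-ordered.\<close>

definition weight :: "'a topology \<Rightarrow> 'a set rel"
  where "weight T =
    |SOME \<B>. is_base T \<B> \<and> (\<forall>\<B>'. is_base T \<B>' \<longrightarrow> |\<B>| \<le>o |\<B>'| )|"

lemma least_base_exists: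
  "\<exists>\<B>. is_base T \<B> \<and> (\<forall>\<B>'. is_base T \<B>' \<longrightarrow> |\<B>| \<le>o |\<B>'| )"
proof -
  have "is_base T {U. openin T U}"
    by (auto simp: is_base_def)
  then have "card_of ` {\<B>. is_base T \<B>} \<noteq> {}" by blast
  moreover have "\<forall>r \<in> card_of ` {\<B>. is_base T \<B>}. Card_order r"
    by (auto simp: card_of_Card_order)
  ultimately have "\<exists>r \<in> card_of ` {\<B>. is_base T \<B>}. \<forall>r' \<in> card_of ` {\<B>. is_base T \<B>}. r \<le>o r'"
    by (rule exists_minim_Card_order)
  then show ?thesis by auto
qed

lemma weight_ordLeq_iff: "weight T \<le>o r \<longleftrightarrow> (\<exists>\<B>. is_base T \<B> \<and> |\<B>| \<le>o r)"
proof -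
  define P where "P \<B> \<longleftrightarrow> is_base T \<B> \<and> (\<forall>\<B>'. is_base T \<B>' \<longrightarrow> |\<B>| \<le>o |\<B>'| )" for \<B>
  have w: "weight T = |SOME \<B>. P \<B>|"
    by (simp add: weight_def P_def)
  have P: "P (SOME \<B>. P \<B>)"
    using least_base_exists[of T] unfolding P_def by (rule someI_ex)
  show ?thesis
  proof
    assume "weight T \<le>o r"
    with P show "\<exists>\<B>. is_base T \<B> \<and> |\<B>| \<le>o r"
      unfolding w by (metis P_def)
  next
    assume "\<exists>\<B>. is_base T \<B> \<and> |\<B>| \<le>o r"
    then obtain \<B> where "is_base T \<B>" "|\<B>| \<le>o r" by blast
    with P show "weight T \<le>o r"
      unfolding w by (metis P_def ordLeq_transitive)
  qed
qed


section \<open>Coarse spaces\<close>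

definition entourage :: "'a set \<Rightarrow> ('a \<times> 'a) set \<Rightarrow> bool"
  where "entourage X E \<longleftrightarrow> Id_on X \<subseteq> E \<and> E \<subseteq> X \<times> X"

definition coarse_space :: "'a set \<Rightarrow> ('a \<times> 'a) set set \<Rightarrow> bool"
  where "coarse_space X \<E> \<longleftrightarrow>
    (\<forall>E\<in>\<E>. entourage X E) \<and>
    \<Union>\<E> = X \<times> X \<and>
    (\<forall>E\<in>\<E>. \<forall>F\<in>\<E>. \<exists>G\<in>\<E>. E O F\<inverse> \<subseteq> G) \<and>
    (\<forall>E F. Id_on X \<subseteq> E \<and> E \<subseteq> F \<and> F \<in> \<E> \<longrightarrow> E \<in> \<E>)"

definition coarsely_bounded :: "'a set \<Rightarrow> ('a \<times> 'a) set set \<Rightarrow> 'a set \<Rightarrow> bool"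
  where "coarsely_bounded X \<E> B \<longleftrightarrow> B \<subseteq> X \<and> (\<exists>E\<in>\<E>. \<exists>x\<in>X. B \<subseteq> E `` {x})"

text \<open>The explicit finiteness is needed because \<^term>\<open>card A = 0\<close> for infinite \<open>A\<close>.\<close>

definition finitary :: "'a set \<Rightarrow> ('a \<times> 'a) set set \<Rightarrow> bool"
  where "finitary X \<E> \<longleftrightarrow>
    (\<forall>E\<in>\<E>. \<exists>n. \<forall>x\<in>X. finite (E `` {x}) \<and> card (E `` {x}) \<le> n)"

definition cellular :: "'a set \<Rightarrow> ('a \<times> 'a) set set \<Rightarrow> bool"
  where "cellular X \<E> \<longleftrightarrow> (\<forall>E\<in>\<E>. \<exists>B\<in>\<E>. E \<subseteq> B \<and> equiv X B)"


section \<open>Slowly oscillating functions and the Higson corona\<close>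

text \<open>The metric boundedness of \<open>\<phi> ` (E `` {x})\<close> says that its diameter is finite:
  \<^const>\<open>diameter\<close> is real-valued and unspecified on unbounded sets.\<close>

definition slowly_oscillating :: "'a set \<Rightarrow> ('a \<times> 'a) set set \<Rightarrow> ('a \<Rightarrow> real) \<Rightarrow> bool"
  where "slowly_oscillating X \<E> \<phi> \<longleftrightarrow>
    (\<forall>\<epsilon>>0. \<forall>E\<in>\<E>. \<exists>B. coarsely_bounded X \<E> B \<and>
      (\<forall>x\<in>X - B. bounded (\<phi> ` (E `` {x})) \<and> diameter (\<phi> ` (E `` {x})) < \<epsilon>))"

text \<open>Functions on \<open>X\<close> are represented by their extensional representatives, so that
  each function \<open>X \<Rightarrow> \<real>\<close> gives exactly one coordinate of the product below.\<close>

definition so_functions :: "'a set \<Rightarrow> ('a \<times> 'a) set set \<Rightarrow> ('a \<Rightarrow> real) set"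
  where "so_functions X \<E> =
    {\<phi> \<in> X \<rightarrow>\<^sub>E UNIV. bounded (\<phi> ` X) \<and> slowly_oscillating X \<E> \<phi>}"

definition higson_map :: "'a set \<Rightarrow> ('a \<times> 'a) set set \<Rightarrow> 'a \<Rightarrow> ('a \<Rightarrow> real) \<Rightarrow> real"
  where "higson_map X \<E> x = (\<lambda>f\<in>so_functions X \<E>. f x)"

definition higson_compactification ::
    "'a set \<Rightarrow> ('a \<times> 'a) set set \<Rightarrow> (('a \<Rightarrow> real) \<Rightarrow> real) topology"
  where "higson_compactification X \<E> =
    (let P = product_topology (\<lambda>_. euclideanreal) (so_functions X \<E>)
     in subtopology P (P closure_of (higson_map X \<E> ` X)))"

definition higson_corona ::
    "'a set \<Rightarrow> ('a \<times> 'a) set set \<Rightarrow> (('a \<Rightarrow> real) \<Rightarrow> real) topology"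
  where "higson_corona X \<E> =
    (let H = higson_compactification X \<E>
     in subtopology H
          (topspace H - \<Union>{H closure_of (higson_map X \<E> ` B) | B. coarsely_bounded X \<E> B}))"

end

theory Submission
  imports Defs "HOL-Library.Countable_Set_Type"
begin

text \<open>
  A compact Hausdorff space \<open>K\<close> of weight at most \<open>\<omega>\<^sub>1\<close> embeds into a cube by continuous functions
  \<open>\<kappa>\<^sub>\<alpha> : K \<rightarrow> [0,1]\<close>, \<open>\<alpha> < \<omega>\<^sub>1\<close>.  Transfinite recursion of length \<open>\<omega>\<^sub>1\<close> constructs functions
  \<open>f\<^sub>\<alpha> : \<omega> \<rightarrow> [0,1]\<close> for which the diagonal map into the cube has exactly the image of \<open>K\<close> as its set of
  cluster points at infinity, and, interleaved with them, equivalence relations \<open>E\<^sub>\<alpha>\<close> on \<open>\<omega>\<close> with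
  classes of at most two points.  The coarse structure is generated by the \<open>E\<^sub>\<alpha>\<close> and the finite squares.
  Every \<open>f\<^sub>\<alpha>\<close> is to be slowly oscillating, and no bounded function that fails to extend
  continuously over \<open>K\<close> may be.  The Continuum Hypothesis is what makes the second demand attainable: the
  pairs \<open>(A,B)\<close> of subsets of \<open>\<omega>\<close> can be listed in type \<open>\<omega>\<^sub>1\<close>, so that each is
  treated at a stage \<open>\<alpha>\<close> before which only countably many objects have been built.

  Stage \<open>\<alpha>\<close>.  Finite joins of earlier relations \<open>E\<^sub>\<beta>\<close> have finite classes, and along each of them the
  earlier \<open>f\<^sub>\<beta>\<close> oscillate less and less.  A diagonal argument (\<open>coarsening\<close>) replaces these countably many
  relations by a single equivalence relation \<open>P\<close> with finite classes that contains each of them up to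
  finitely many pairs and along which the \<open>f\<^sub>\<beta>\<close> still oscillate less and less.  The function \<open>f\<^sub>\<alpha>\<close> is
  chosen constant on the classes of \<open>P\<close>, hence asymptotically constant along every \<open>E\<^sub>\<beta>\<close>
  (\<open>new_coordinate\<close>, a version of the inductive step in Parovichenko's theorem).  If
  points of \<open>A\<^sub>\<alpha>\<close> and of \<open>B\<^sub>\<alpha>\<close> arbitrarily far out cannot be told apart by finitely many of the
  \<open>f\<^sub>\<beta>\<close>, \<open>\<beta> \<le> \<alpha>\<close>, then \<open>E\<^sub>\<alpha>\<close> links a sequence of points of \<open>A\<^sub>\<alpha>\<close> to a sequence of points of \<open>B\<^sub>\<alpha>\<close> with
  vanishing differences of every \<open>f\<^sub>\<beta>\<close> (\<open>link_sets\<close>).  The links are placed in different classes of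
  \<open>P\<close>, so joining \<open>E\<^sub>\<alpha>\<close> to earlier relations at most doubles classes outside a finite set
  (\<open>join_transversal\<close>).  This keeps the coarse structure finitary and cellular.

  In the end, if \<open>\<phi>\<close> is slowly oscillating and \<open>a < b\<close>, then the sets \<open>{\<phi> \<le> a}\<close> and \<open>{\<phi> \<ge> b}\<close> were
  not linked, so finitely many \<open>f\<^sub>\<beta>\<close> separate them (\<open>slowly_oscillating_separated\<close>).  Consequently \<open>\<phi>\<close>
  has a limit at each point of \<open>K\<close>, and sending a point to the family of these limits is the desired
  homeomorphism of \<open>K\<close> onto the corona.
\<close>

section \<open>Uniformly finite relations\<close>

definition bounded_fibres :: "('b \<times> 'b) set \<Rightarrow> bool"
  where "bounded_fibres S \<longleftrightarrow> (\<exists>M. \<forall>x. finite (S `` {x}) \<and> card (S `` {x}) \<le> M)"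

text \<open>Both directions are bounded, as composition must preserve not only this property but also
  finiteness of exceptional sets of pairs, which involves predecessors.\<close>

definition uniformly_finite :: "('b \<times> 'b) set \<Rightarrow> bool"
  where "uniformly_finite S \<longleftrightarrow> bounded_fibres S \<and> bounded_fibres (S\<inverse>)"

lemma uniformly_finiteD:
  assumes "uniformly_finite S" shows "finite (S `` {x})" "finite (S\<inverse> `` {x})"
  using assms unfolding uniformly_finite_def bounded_fibres_def by auto

lemma bounded_fibres_subset:
  assumes "bounded_fibres T" "S \<subseteq> T" shows "bounded_fibres S"
proof -
  have "S `` {x} \<subseteq> T `` {x}" for x using \<open>S \<subseteq> T\<close> by blast
  then show ?thesis
    using assms(1) unfolding bounded_fibres_def
    by (meson card_mono finite_subset order_trans)
qed

lemma bounded_fibres_comp: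
  assumes "bounded_fibres S" "bounded_fibres T" shows "bounded_fibres (S O T)"
proof -
  obtain M N where M: "\<And>x. finite (S `` {x}) \<and> card (S `` {x}) \<le> M"
    and N: "\<And>x. finite (T `` {x}) \<and> card (T `` {x}) \<le> N"
    using assms unfolding bounded_fibres_def by auto
  have eq: "(S O T) `` {x} = (\<Union>y\<in>S `` {x}. T `` {y})" for x by auto
  have "card ((S O T) `` {x}) \<le> M * N" for x
  proof -
    have "card ((S O T) `` {x}) \<le> (\<Sum>y\<in>S `` {x}. card (T `` {y}))"
      unfolding eq using M by (intro card_UN_le) auto
    also have "\<dots> \<le> (\<Sum>y\<in>S `` {x}. N)"
      using N by (intro sum_mono) auto
    also have "\<dots> \<le> M * N" using M by simp
    finally show ?thesis .
  qed
  moreover have "finite ((S O T) `` {x})" for x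
    unfolding eq using M N by auto
  ultimately show ?thesis unfolding bounded_fibres_def by blast
qed

lemma uniformly_finite_subset:
  assumes "uniformly_finite T" "S \<subseteq> T" shows "uniformly_finite S"
proof -
  have "S\<inverse> \<subseteq> T\<inverse>" using assms(2) by auto
  then show ?thesis
    using assms bounded_fibres_subset unfolding uniformly_finite_def by blast
qed

lemma uniformly_finite_comp:
  assumes "uniformly_finite S" "uniformly_finite T" shows "uniformly_finite (S O T)"
  using assms unfolding uniformly_finite_def converse_relcomp by (blast intro: bounded_fibres_comp)

lemma uniformly_finite_Id_Un_square:
  assumes "finite C" shows "uniformly_finite (Id \<union> C \<times> C)"
proof -
  have sub: "(Id \<union> C \<times> C) `` {x} \<subseteq> insert x C" for x by auto
  have 1: "finite ((Id \<union> C \<times> C) `` {x})" for x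
    by (rule finite_subset[OF sub]) (simp add: assms)
  have 2: "card ((Id \<union> C \<times> C) `` {x}) \<le> Suc (card C)" for x
  proof -
    have "card ((Id \<union> C \<times> C) `` {x}) \<le> card (insert x C)"
      by (rule card_mono[OF _ sub]) (simp add: assms)
    also have "\<dots> \<le> Suc (card C)" using assms by (simp add: card_insert_if)
    finally show ?thesis .
  qed
  have 3: "(Id \<union> C \<times> C)\<inverse> = Id \<union> C \<times> C" by auto
  show ?thesis unfolding uniformly_finite_def bounded_fibres_def 3 using 1 2 by blast
qed

lemma finite_comp_Diff:
  assumes "finite (S - P)" "finite (T - Q)"
    and "\<And>x. finite (S\<inverse> `` {x})" "\<And>x. finite (T `` {x})"
  shows "finite (S O T - P O Q)"
proof -
  have "S O T - P O Q \<subseteq> (\<Union>(u,v)\<in>S - P. {u} \<times> T `` {v}) \<union> (\<Union>(v,w)\<in>T - Q. S\<inverse> `` {v} \<times> {w})"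
    by blast
  moreover have "finite \<dots>" using assms by auto
  ultimately show ?thesis by (rule finite_subset)
qed

text \<open>Slow oscillation along a single relation: when the bounded sets are the finite ones
  and the fibres are finite, finitely many exceptional pairs amount to a bounded exceptional set of points.\<close>

definition asymptotically_constant :: "('b \<Rightarrow> real) \<Rightarrow> ('b \<times> 'b) set \<Rightarrow> bool"
  where "asymptotically_constant f S \<longleftrightarrow> (\<forall>\<epsilon>>0. finite (S - {(u,v). \<bar>f u - f v\<bar> < \<epsilon>}))"

lemma asymptotically_constantD:
  "asymptotically_constant f S \<Longrightarrow> \<epsilon> > 0 \<Longrightarrow> finite (S - {(u,v). \<bar>f u - f v\<bar> < \<epsilon>})"
  by (simp add: asymptotically_constant_def)

lemma asymptotically_constant_subset:
  "asymptotically_constant f T \<Longrightarrow> S \<subseteq> T \<Longrightarrow> asymptotically_constant f S"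
  unfolding asymptotically_constant_def by (meson Diff_mono finite_subset order_refl)

lemma asymptotically_constant_almost_subset:
  assumes "asymptotically_constant f T" "finite (S - T)" shows "asymptotically_constant f S"
proof -
  have "S - {(u,v). \<bar>f u - f v\<bar> < \<epsilon>} \<subseteq> (S - T) \<union> (T - {(u,v). \<bar>f u - f v\<bar> < \<epsilon>})" for \<epsilon> by blast
  then show ?thesis
    using assms unfolding asymptotically_constant_def by (meson finite_Un finite_subset)
qed

lemma asymptotically_constant_comp:
  assumes "asymptotically_constant f S" "asymptotically_constant f T"
    and "uniformly_finite S" "uniformly_finite T"
  shows "asymptotically_constant f (S O T)"
  unfolding asymptotically_constant_def
proof (intro allI impI)
  fix \<epsilon> :: real assume "\<epsilon> > 0"
  let ?Q = "{(u,v). \<bar>f u - f v\<bar> < \<epsilon>/2}"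
  have "finite (S - ?Q)" "finite (T - ?Q)"
    using assms(1,2) \<open>\<epsilon> > 0\<close> unfolding asymptotically_constant_def by (meson half_gt_zero)+
  then have "finite (S O T - ?Q O ?Q)"
    using assms(3,4) by (intro finite_comp_Diff) (auto dest: uniformly_finiteD)
  moreover have "?Q O ?Q \<subseteq> {(u,v). \<bar>f u - f v\<bar> < \<epsilon>}"
  proof clarify
    fix x y z assume "\<bar>f x - f y\<bar> < \<epsilon>/2" "\<bar>f y - f z\<bar> < \<epsilon>/2"
    then show "\<bar>f x - f z\<bar> < \<epsilon>" by argo
  qed
  ultimately show "finite (S O T - {(u,v). \<bar>f u - f v\<bar> < \<epsilon>})"
    by (meson Diff_mono finite_subset order_refl)
qed

text \<open>Finite compositions of the generating relations \<open>E i\<close>, \<open>i \<in> U\<close>, and of finite squares.  The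
  coarse structure will consist of the subrelations of words.  Words have uniformly bounded fibres by
  induction, while this is not clear for the transitive closure of their generators.\<close>

inductive_set words :: "('i \<Rightarrow> ('b \<times> 'b) set) \<Rightarrow> 'i set \<Rightarrow> ('b \<times> 'b) set set" for E U where
  gen: "i \<in> U \<Longrightarrow> E i \<in> words E U"
| square: "finite C \<Longrightarrow> Id \<union> C \<times> C \<in> words E U"
| comp: "S \<in> words E U \<Longrightarrow> T \<in> words E U \<Longrightarrow> S O T \<in> words E U"

lemma words_mono:
  assumes "U \<subseteq> V" shows "words E U \<subseteq> words E V"
proof
  fix S assume "S \<in> words E U" then show "S \<in> words E V"
  proof induction
    case (gen i)
    then show ?case using assms by (intro words.gen) blast
  qed (rule words.square words.comp, assumption+)+
qed

lemma words_uniformly_finite: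
  assumes "S \<in> words E U" and "\<And>i. i \<in> U \<Longrightarrow> uniformly_finite (E i)"
  shows "uniformly_finite S"
  using assms(1)
proof induction
  case (gen i) then show ?case by (rule assms(2))
next
  case (square C) then show ?case by (rule uniformly_finite_Id_Un_square)
next
  case (comp S T) show ?case using comp.IH by (rule uniformly_finite_comp)
qed

lemma words_asymptotically_constant:
  assumes "S \<in> words E U" and "\<And>i. i \<in> U \<Longrightarrow> uniformly_finite (E i)"
    and "\<And>i. i \<in> U \<Longrightarrow> asymptotically_constant f (E i)"
  shows "asymptotically_constant f S"
  using assms(1)
proof induction
  case (gen i) then show ?case by (rule assms(3))
next
  case (comp S T)
  have "uniformly_finite S" "uniformly_finite T"
    using comp.hyps words_uniformly_finite[where E=E and U=U, OF _ assms(2)] by blast+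
  with comp.IH show ?case by (rule asymptotically_constant_comp)
next
  case (square C)
  have "finite (Id \<union> C \<times> C - {(u,v). \<bar>f u - f v\<bar> < \<epsilon>})" if "\<epsilon> > 0" for \<epsilon>
    by (rule finite_subset[of _ "C \<times> C"]) (use that square in auto)
  then show ?case by (simp add: asymptotically_constant_def)
qed

lemma words_almost_subset_equiv:
  assumes "S \<in> words E U" and "\<And>i. i \<in> U \<Longrightarrow> uniformly_finite (E i)"
    and "equiv UNIV P" and "\<And>i. i \<in> U \<Longrightarrow> finite (E i - P)"
  shows "finite (S - P)"
  using assms(1)
proof induction
  case (square C)
  show ?case
    by (rule finite_subset[of _ "C \<times> C"])
      (use square \<open>equiv UNIV P\<close> in \<open>auto simp: equiv_def refl_on_def\<close>)
next
  case (comp S T)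
  have "finite (S O T - P O P)"
    using comp.IH comp.hyps[THEN words_uniformly_finite[where E=E and U=U, OF _ assms(2)]]
    by (intro finite_comp_Diff uniformly_finiteD)
  moreover have "P O P \<subseteq> P"
    using \<open>equiv UNIV P\<close> by (auto simp: equiv_def dest: transD)
  ultimately show ?case by (meson Diff_mono finite_subset order_refl)
next
  case (gen i) then show ?case by (rule assms(4))
qed

text \<open>A word uses finitely many generators, so every equivalence relation that contains these contains the
  word by transitivity.  Cellularity is thereby reduced to finding, inside some word, an equivalence
  relation that contains given finitely many generators.\<close>

lemma words_subset_equiv:
  assumes "S \<in> words E U"
  shows "\<exists>F C. finite F \<and> F \<subseteq> U \<and> finite C \<and>
    (\<forall>J. equiv UNIV J \<and> (\<forall>i\<in>F. E i \<subseteq> J) \<and> C \<times> C \<subseteq> J \<longrightarrow> S \<subseteq> J)"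
  using assms
proof induction
  case (gen i)
  then show ?case by (intro exI[of _ "{i}"] exI[of _ "{}"]) auto
next
  case (square C)
  then show ?case
    by (intro exI[of _ "{}"] exI[of _ C]) (auto simp: equiv_def refl_on_def)
next
  case (comp S T)
  from comp.IH(1) obtain F C where 1: "finite F" "F \<subseteq> U" "finite C"
    and S: "\<forall>J. equiv UNIV J \<and> (\<forall>i\<in>F. E i \<subseteq> J) \<and> C \<times> C \<subseteq> J \<longrightarrow> S \<subseteq> J"
    by (elim exE conjE)
  from comp.IH(2) obtain F' C' where 2: "finite F'" "F' \<subseteq> U" "finite C'"
    and T: "\<forall>J. equiv UNIV J \<and> (\<forall>i\<in>F'. E i \<subseteq> J) \<and> C' \<times> C' \<subseteq> J \<longrightarrow> T \<subseteq> J"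
    by (elim exE conjE)
  have ST: "S O T \<subseteq> J" if J: "equiv UNIV J" "\<forall>i\<in>F \<union> F'. E i \<subseteq> J" "(C \<union> C') \<times> (C \<union> C') \<subseteq> J" for J
  proof -
    have "C \<times> C \<subseteq> J" "C' \<times> C' \<subseteq> J" using J(3) by blast+
    then have "S \<subseteq> J" "T \<subseteq> J" using S[rule_format, of J] T[rule_format, of J] J(1,2) by blast+
    moreover have "trans J" using J(1) by (simp add: equiv_def)
    ultimately show ?thesis by (meson relcomp_mono order_trans trans_O_subset)
  qed
  show ?case
  proof (rule exI[of _ "F \<union> F'"], rule exI[of _ "C \<union> C'"], intro conjI allI impI)
    fix J assume "equiv UNIV J \<and> (\<forall>i\<in>F \<union> F'. E i \<subseteq> J) \<and> (C \<union> C') \<times> (C \<union> C') \<subseteq> J"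
    then show "S O T \<subseteq> J" by (elim conjE) (rule ST)
  qed (use 1 2 in auto)
qed

section \<open>Joining a relation with a transversal one\<close>

text \<open>Distinct nontrivial classes of \<open>E\<close> meet disjoint families of classes of \<open>P\<close>.\<close>

definition transversal :: "('b \<times> 'b) set \<Rightarrow> ('b \<times> 'b) set \<Rightarrow> bool"
  where "transversal E P \<longleftrightarrow>
    (\<forall>s t. s \<in> Field (E - Id) \<and> t \<in> Field (E - Id) \<and> (s,t) \<in> P \<longrightarrow> (s,t) \<in> E)"

text \<open>Let \<open>R\<close> be contained in \<open>P\<close> up to finitely many pairs and \<open>E\<close> transversal to \<open>P\<close>.  Away from a finite
  set \<open>D\<close> that is saturated for both \<open>R\<close> and \<open>E\<close>, two \<open>E\<close>-links met by the same \<open>R\<close>-class lie over a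
  common class of \<open>P\<close> and so form a single link.  Hence chains of \<open>R\<close>- and \<open>E\<close>-steps
  collapse to the pattern \<open>R O E O R\<close>, and the join is contained in a word.\<close>

lemma join_transversal:
  assumes R: "equiv UNIV R" and P: "equiv UNIV P" and E: "equiv UNIV E"
    and finP: "\<And>x. finite (P `` {x})" and finE: "\<And>x. finite (E `` {x})"
    and RP: "finite (R - P)" and tr: "transversal E P" and "finite C"
  obtains D where "finite D" "C \<subseteq> D" "equiv UNIV (R O E O R \<union> D \<times> D)"
proof -
  \<comment> \<open>Saturating for \<open>P\<close>, then \<open>E\<close>, then \<open>P\<close> again suffices: an \<open>E\<close>-link that starts in the last layer is, by transversality, one already used in the middle layer.\<close>
  define C0 where "C0 = Field (R - P) \<union> C"
  have "finite C0" unfolding C0_def using RP \<open>finite C\<close> by (simp add: finite_Field)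
  define C1 where "C1 = P `` C0"
  define D where "D = P `` E `` C1"
  have fin_image: "finite (S `` A)" if "finite A" "\<And>x. finite (S `` {x})" for S :: "('a \<times> 'a) set" and A
    using that by (subst Image_eq_UN) auto
  have "finite D"
    unfolding D_def C1_def using \<open>finite C0\<close> finP finE fin_image by metis
  have Pr: "(x,x) \<in> P" and Er: "(x,x) \<in> E" and Rr: "(x,x) \<in> R" for x
    using P E R by (auto simp: equiv_def refl_on_def)
  have Ps: "(x,y) \<in> P \<Longrightarrow> (y,x) \<in> P" and Es: "(x,y) \<in> E \<Longrightarrow> (y,x) \<in> E"
    and Rs: "(x,y) \<in> R \<Longrightarrow> (y,x) \<in> R" for x y
    using P E R by (auto simp: equiv_def dest: symD)
  have Pt: "(x,y) \<in> P \<Longrightarrow> (y,z) \<in> P \<Longrightarrow> (x,z) \<in> P" and Et: "(x,y) \<in> E \<Longrightarrow> (y,z) \<in> E \<Longrightarrow> (x,z) \<in> E"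
    and Rt: "(x,y) \<in> R \<Longrightarrow> (y,z) \<in> R \<Longrightarrow> (x,z) \<in> R" for x y z
    using P E R by (meson equivE transD)+
  have "C0 \<subseteq> C1" "C1 \<subseteq> E `` C1" "E `` C1 \<subseteq> D"
    unfolding C1_def D_def using Pr Er by blast+
  have DP: "y \<in> D" if "x \<in> D" "(x,y) \<in> P" for x y
    using that Pt unfolding D_def by blast
  have DR: "y \<in> D" if "x \<in> D" "(x,y) \<in> R" for x y
  proof (cases "(x,y) \<in> P")
    case False
    then have "y \<in> C0" using that by (auto simp: C0_def Field_def)
    then show ?thesis using \<open>C0 \<subseteq> C1\<close> \<open>C1 \<subseteq> E `` C1\<close> \<open>E `` C1 \<subseteq> D\<close> by auto
  qed (use DP that in blast)
  have DE: "y \<in> D" if "x \<in> D" and xy: "(x,y) \<in> E" for x y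
  proof (cases "x = y")
    case False
    from \<open>x \<in> D\<close> obtain w c where w: "(w,x) \<in> P" "(c,w) \<in> E" "c \<in> C1" unfolding D_def by blast
    have "y \<in> E `` C1"
    proof (cases "w = c")
      case True
      then have "x \<in> C1" using w Pt unfolding C1_def by blast
      then show ?thesis using xy by blast
    next
      case cw: False
      have "w \<in> Field (E - Id)" "x \<in> Field (E - Id)"
        using w xy cw False by (auto simp: Field_def)
      then have "(w,x) \<in> E" using tr w(1) unfolding transversal_def by blast
      then show ?thesis using w xy Et by blast
    qed
    then show ?thesis using \<open>E `` C1 \<subseteq> D\<close> by blast
  qed (use that in simp)
  let ?W = "R O E O R"
  have Ws: "(v,u) \<in> ?W" if "(u,v) \<in> ?W" for u v
    using that Rs Es by blast
  have DW: "v \<in> D" if "(u,v) \<in> ?W" "u \<in> D" for u v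
    using that DR DE by blast
  have Wt: "(u,w) \<in> ?W" if "(u,v) \<in> ?W" "(v,w) \<in> ?W" "v \<notin> D" for u v w
  proof -
    obtain u' v' where 1: "(u,u') \<in> R" "(u',v') \<in> E" "(v',v) \<in> R" using \<open>(u,v) \<in> ?W\<close> by blast
    obtain v'' w' where 2: "(v,v'') \<in> R" "(v'',w') \<in> E" "(w',w) \<in> R" using \<open>(v,w) \<in> ?W\<close> by blast
    have v: "(v',v'') \<in> R" using 1 2 Rt by blast
    have "v' \<notin> D" using 1 \<open>v \<notin> D\<close> DR by blast
    then have "v' \<notin> C0" using \<open>C0 \<subseteq> C1\<close> \<open>C1 \<subseteq> E `` C1\<close> \<open>E `` C1 \<subseteq> D\<close> by auto
    then have vP: "(v',v'') \<in> P" using v by (auto simp: C0_def Field_def)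
    consider "u' = v'" | "v'' = w'" | "u' \<noteq> v'" "v'' \<noteq> w'" by blast
    then show ?thesis
    proof cases
      case 3
      then have "v' \<in> Field (E - Id)" "v'' \<in> Field (E - Id)"
        using 1 2 by (auto simp: Field_def)
      then have "(v',v'') \<in> E" using tr vP unfolding transversal_def by blast
      then show ?thesis using 1 2 Et by blast
    qed (use 1 2 v Rt in blast)+
  qed
  have "equiv UNIV (?W \<union> D \<times> D)"
  proof (rule equivI)
    show "refl_on UNIV (?W \<union> D \<times> D)"
      using Rr Er by (auto simp: refl_on_def)
    show "sym (?W \<union> D \<times> D)" using Ws by (intro symI) blast
    show "trans (?W \<union> D \<times> D)"
    proof (rule transI)
      fix u v w assume *: "(u,v) \<in> ?W \<union> D \<times> D" "(v,w) \<in> ?W \<union> D \<times> D"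
      show "(u,w) \<in> ?W \<union> D \<times> D"
      proof (cases "v \<in> D")
        case True
        then have "u \<in> D" "w \<in> D" using * DW Ws by blast+
        then show ?thesis by blast
      qed (use * Wt in blast)
    qed
  qed auto
  moreover have "C \<subseteq> D"
    using \<open>C0 \<subseteq> C1\<close> \<open>C1 \<subseteq> E `` C1\<close> \<open>E `` C1 \<subseteq> D\<close> unfolding C0_def by blast
  ultimately show ?thesis using that \<open>finite D\<close> by blast
qed

section \<open>Diagonal arguments\<close>

text \<open>Exhaust \<open>\<nat>\<close> by finite sets \<open>D i\<close>, each \<open>R i\<close>-saturated
  and so large that all pairs of \<open>R (i+1) - Q (i+1)\<close> lie inside \<open>D i\<close>; on the shell between \<open>D (i-1)\<close> and \<open>D i\<close>
  use the relation \<open>R i\<close>.  Shells beyond \<open>D k\<close> are \<open>R k\<close>-saturated, which is why \<open>R k\<close> is almost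
  contained in the resulting relation; the latter is almost contained in \<open>Q k\<close> because shells
  beyond \<open>D k\<close> avoid the exceptional pairs.\<close>

lemma coarsening:
  fixes R Q :: "nat \<Rightarrow> (nat \<times> nat) set"
  assumes R: "\<And>i. equiv UNIV (R i)" and finR: "\<And>i x. finite (R i `` {x})"
    and mono: "\<And>i j. i \<le> j \<Longrightarrow> R i \<subseteq> R j"
    and Qmono: "\<And>i j. i \<le> j \<Longrightarrow> Q j \<subseteq> Q i"
    and RQ: "\<And>i. finite (R i - Q i)"
  shows "\<exists>P. equiv UNIV P \<and> (\<forall>x. finite (P `` {x})) \<and>
    (\<forall>i. finite (R i - P)) \<and> (\<forall>i. finite (P - Q i))"
proof -
  have Rr: "(x,x) \<in> R i" for x i
    using R[of i] by (auto simp: equiv_def refl_on_def)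
  have Rs: "(y,x) \<in> R i" if "(x,y) \<in> R i" for x y i
    using R[of i] that by (auto simp: equiv_def dest: symD)
  have Rt: "(x,z) \<in> R i" if "(x,y) \<in> R i" "(y,z) \<in> R i" for x y z i
    using R[of i] that by (meson equivE transD)
  have finI: "finite (R i `` A)" if "finite A" for A i
    using that finR by (subst Image_eq_UN) auto
  define D where "D = rec_nat (R 0 `` ({0} \<union> Field (R 1 - Q 1)))
    (\<lambda>i A. R (Suc i) `` (A \<union> {Suc i} \<union> Field (R (Suc (Suc i)) - Q (Suc (Suc i)))))"
  have D0: "D 0 = R 0 `` ({0} \<union> Field (R 1 - Q 1))"
    and DSuc: "D (Suc i) = R (Suc i) `` (D i \<union> {Suc i} \<union> Field (R (Suc (Suc i)) - Q (Suc (Suc i))))" for i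
    by (simp_all add: D_def)
  have finD: "finite (D i)" for i
  proof (induction i)
    case 0 show ?case unfolding D0 using RQ by (intro finI) (simp add: finite_Field)
  next
    case (Suc i) then show ?case unfolding DSuc using RQ by (intro finI) (simp add: finite_Field)
  qed
  have Dim: "\<exists>X. D i = R i `` X \<and> i \<in> X \<and> Field (R (Suc i) - Q (Suc i)) \<subseteq> X" for i
  proof (cases i)
    case 0 then show ?thesis using D0
      by (intro exI[of _ "{0} \<union> Field (R 1 - Q 1)"]) auto
  next
    case (Suc k)
    show ?thesis unfolding Suc using DSuc[of k]
      by (intro exI[of _ "D k \<union> {Suc k} \<union> Field (R (Suc (Suc k)) - Q (Suc (Suc k)))"]) blast
  qed
  have Dsat: "y \<in> D i" if "x \<in> D i" "(x,y) \<in> R i" for x y i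
    using Dim[of i] that Rt by blast
  have "D i \<subseteq> D (Suc i)" for i unfolding DSuc using Rr by blast
  then have Dmono: "D i \<subseteq> D j" if "i \<le> j" for i j using that by (rule lift_Suc_mono_le)
  have inD: "i \<in> D i" for i using Dim[of i] Rr by blast
  have bad: "Field (R (Suc i) - Q (Suc i)) \<subseteq> D i" for i
    using Dim[of i] Rr by blast
  define l where "l x = (LEAST i. x \<in> D i)" for x
  have l1: "x \<in> D (l x)" for x unfolding l_def using inD by (rule LeastI)
  have l2: "l x \<le> i" if "x \<in> D i" for x i unfolding l_def using that by (rule Least_le)
  define P where "P = {(x,y). l x = l y \<and> (x,y) \<in> R (l x)}"
  have "equiv UNIV P"
  proof (rule equivI)
    show "refl_on UNIV P" using Rr by (simp add: P_def refl_on_def)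
    show "sym P" unfolding P_def sym_def using Rs by auto
    show "trans P" unfolding P_def trans_def using Rt by auto
  qed auto
  moreover have "finite (P `` {x})" for x
    by (rule finite_subset[OF _ finR[of "l x" x]]) (auto simp: P_def)
  moreover have "finite (R i - P)" for i
  proof (rule finite_subset)
    show "R i - P \<subseteq> D i \<times> D i"
    proof clarify
      fix x y assume xy: "(x,y) \<in> R i" "(x,y) \<notin> P"
      show "x \<in> D i \<and> y \<in> D i"
      proof (rule ccontr)
        assume "\<not> (x \<in> D i \<and> y \<in> D i)"
        then have nin: "x \<notin> D i" "y \<notin> D i" using Dsat xy(1) Rs by blast+
        have li: "i < l x" "i < l y" using nin l1 Dmono by (meson linorder_not_less subsetD)+
        have "(x,y) \<in> R (l x)" "(y,x) \<in> R (l y)" using li mono[of i] xy(1) Rs by (meson less_imp_le subsetD)+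
        then have "y \<in> D (l x)" "x \<in> D (l y)" using Dsat l1 by blast+
        then have "l x = l y" by (simp add: antisym l2)
        then show False using xy \<open>(x,y) \<in> R (l x)\<close> by (simp add: P_def)
      qed
    qed
  qed (simp add: finD)
  moreover have "finite (P - Q i)" for i
  proof (rule finite_subset)
    show "P - Q i \<subseteq> (SIGMA x : D i. P `` {x})"
    proof clarify
      fix x y assume xy: "(x,y) \<in> P" "(x,y) \<notin> Q i"
      have "l x \<le> i"
      proof (rule ccontr)
        assume "\<not> l x \<le> i"
        then obtain k where k: "l x = Suc k" "i \<le> k" by (cases "l x") auto
        have "(x,y) \<in> R (Suc k) - Q (Suc k)"
          using xy k Qmono[of i "Suc k"] by (auto simp: P_def)
        then have "x \<in> D k" using bad[of k] by (auto simp: Field_def)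
        then show False using l2 k by fastforce
      qed
      then show "x \<in> D i \<and> y \<in> P `` {x}" using l1 Dmono xy by blast
    qed
    show "finite (SIGMA x : D i. P `` {x})"
      using finD \<open>\<And>x. finite (P `` {x})\<close> by blast
  qed
  ultimately show ?thesis by blast
qed

lemma countable_exhaustion:
  assumes "countable U"
  shows "\<exists>F :: nat \<Rightarrow> 'i set. (\<forall>i. finite (F i)) \<and> (\<forall>i j. i \<le> j \<longrightarrow> F i \<subseteq> F j) \<and> (\<Union>i. F i) = U"
proof -
  define F where "F i = {u\<in>U. to_nat_on U u \<le> i}" for i
  have "finite (F i)" for i
  proof (rule finite_imageD)
    show "finite (to_nat_on U ` F i)" by (rule finite_subset[of _ "{..i}"]) (auto simp: F_def)
    show "inj_on (to_nat_on U) (F i)"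
      by (rule inj_on_subset[OF inj_on_to_nat_on[OF assms]]) (auto simp: F_def)
  qed
  moreover have "F i \<subseteq> F j" if "i \<le> j" for i j using that by (auto simp: F_def)
  moreover have "(\<Union>i. F i) = U" by (auto simp: F_def)
  ultimately show ?thesis by blast
qed

text \<open>At \<open>n\<close> choose a point good for as many of the first conditions as possible, counting at most \<open>n\<close> of
  them.\<close>

lemma diagonal_choice:
  fixes Q :: "nat \<Rightarrow> nat \<Rightarrow> 'a \<Rightarrow> bool"
  assumes "K \<noteq> {}"
    and "\<And>i. eventually (\<lambda>n. \<exists>x\<in>K. \<forall>j\<le>i. Q j n x) sequentially"
  shows "\<exists>p. range p \<subseteq> K \<and> (\<forall>i. eventually (\<lambda>n. Q i n (p n)) sequentially)"
proof -
  define S where "S n = {i. i \<le> n \<and> (\<exists>x\<in>K. \<forall>j\<le>i. Q j n x)}" for n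
  have "\<exists>x\<in>K. S n \<noteq> {} \<longrightarrow> (\<forall>j\<le>Max (S n). Q j n x)" for n
  proof (cases "S n = {}")
    case False
    have "finite (S n)" by (simp add: S_def)
    then have "Max (S n) \<in> S n" using False by simp
    then show ?thesis by (auto simp: S_def)
  qed (use assms(1) in auto)
  then obtain p where p: "\<And>n. p n \<in> K" "\<And>n. S n \<noteq> {} \<Longrightarrow> \<forall>j\<le>Max (S n). Q j n (p n)" by metis
  have "eventually (\<lambda>n. Q i n (p n)) sequentially" for i
    using assms(2)[of i] eventually_ge_at_top[of i]
  proof eventually_elim
    case (elim n)
    then have i: "i \<in> S n" by (simp add: S_def)
    moreover have "finite (S n)" by (simp add: S_def)
    ultimately have "i \<le> Max (S n)" by simp
    then show ?case using p(2)[of n] i by blast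
  qed
  then show ?thesis using p(1) by blast
qed

lemma strict_mono_choice:
  assumes "\<And>i N. \<exists>n>N. Q i (n::nat)"
  shows "\<exists>m :: nat \<Rightarrow> nat. strict_mono m \<and> (\<forall>i. Q i (m i))"
proof -
  obtain n0 where n0: "Q 0 n0" using assms by blast
  have "\<exists>m. \<forall>i. Q i (m i) \<and> m i < m (Suc i)"
  proof (rule dependent_nat_choice)
    show "\<exists>x. Q 0 x" using n0 by blast
    show "\<exists>y. Q (Suc n) y \<and> x < y" if "Q n x" for x n using assms[of x "Suc n"] by blast
  qed
  then obtain m where "\<And>i. Q i (m i) \<and> m i < m (Suc i)" by blast
  then show ?thesis by (auto simp: strict_mono_Suc_iff)
qed

text \<open>Countably many real functions on \<open>K\<close> induce a separable pseudometric topology: choose a point for each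
  possible list of values rounded to multiples of \<open>1/m\<close>.  Each chosen point is repeated infinitely often.\<close>

lemma dense_sequence:
  fixes \<kappa> :: "'i \<Rightarrow> 'a \<Rightarrow> real"
  assumes "K \<noteq> {}" "countable U"
  shows "\<exists>q :: nat \<Rightarrow> 'a. range q \<subseteq> K \<and>
    (\<forall>x F \<epsilon>. x \<in> K \<and> finite F \<and> F \<subseteq> U \<and> \<epsilon> > 0 \<longrightarrow>
       frequently (\<lambda>n. \<forall>\<beta>\<in>F. \<bar>\<kappa> \<beta> (q n) - \<kappa> \<beta> x\<bar> < \<epsilon>) sequentially)"
proof -
  define pick where "pick F m g = (SOME x. x \<in> K \<and> (\<forall>\<beta>\<in>F. \<lfloor>real m * \<kappa> \<beta> x\<rfloor> = g \<beta>))" for F m and g :: "'i \<Rightarrow> int"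
  define D where "D = (\<Union>F\<in>{F. finite F \<and> F \<subseteq> U}. \<Union>m. pick F m ` (PiE F (\<lambda>_. UNIV))) \<inter> K"
  have "countable D"
    unfolding D_def
    by (intro countable_Int1 countable_UN countable_image countable_PiE countable_Collect_finite_subset assms) auto
  have approx: "\<exists>y\<in>D. \<forall>\<beta>\<in>F. \<bar>\<kappa> \<beta> y - \<kappa> \<beta> x\<bar> < \<epsilon>"
    if "x \<in> K" "finite F" "F \<subseteq> U" "\<epsilon> > 0" for x F \<epsilon>
  proof -
    obtain m where m: "inverse (real (Suc m)) < \<epsilon>" using reals_Archimedean[OF \<open>\<epsilon> > 0\<close>] by blast
    define g where "g = (\<lambda>\<beta>\<in>F. \<lfloor>real (Suc m) * \<kappa> \<beta> x\<rfloor>)"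
    have "x \<in> K \<and> (\<forall>\<beta>\<in>F. \<lfloor>real (Suc m) * \<kappa> \<beta> x\<rfloor> = g \<beta>)" using that(1) by (simp add: g_def)
    then have y: "pick F (Suc m) g \<in> K \<and> (\<forall>\<beta>\<in>F. \<lfloor>real (Suc m) * \<kappa> \<beta> (pick F (Suc m) g)\<rfloor> = g \<beta>)"
      unfolding pick_def by (rule someI)
    let ?y = "pick F (Suc m) g"
    have "g \<in> PiE F (\<lambda>_. UNIV)" by (simp add: g_def)
    then have "?y \<in> D" using y that(2,3) unfolding D_def by blast
    moreover have "\<bar>\<kappa> \<beta> ?y - \<kappa> \<beta> x\<bar> < \<epsilon>" if "\<beta> \<in> F" for \<beta>
    proof -
      have "\<lfloor>real (Suc m) * \<kappa> \<beta> ?y\<rfloor> = \<lfloor>real (Suc m) * \<kappa> \<beta> x\<rfloor>"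
        using y that by (simp add: g_def)
      then have "\<bar>real (Suc m) * \<kappa> \<beta> ?y - real (Suc m) * \<kappa> \<beta> x\<bar> < 1" by linarith
      then have "\<bar>real (Suc m) * (\<kappa> \<beta> ?y - \<kappa> \<beta> x)\<bar> < 1" by (simp only: right_diff_distrib)
      then have "real (Suc m) * \<bar>\<kappa> \<beta> ?y - \<kappa> \<beta> x\<bar> < 1" by (simp add: abs_mult)
      then have "\<bar>\<kappa> \<beta> ?y - \<kappa> \<beta> x\<bar> < inverse (real (Suc m))"
        by (simp add: field_simps)
      then show ?thesis using m by linarith
    qed
    ultimately show ?thesis by blast
  qed
  have "D \<noteq> {}" using approx[of _ "{}" 1] \<open>K \<noteq> {}\<close> by auto
  define q where "q n = from_nat_into D (fst (prod_decode n))" for n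
  show ?thesis
  proof (intro exI[of _ q] conjI allI impI; (elim conjE)?)
    show "range q \<subseteq> K"
      using from_nat_into[OF \<open>D \<noteq> {}\<close>] by (auto simp: q_def D_def)
    fix x F \<epsilon> assume "x \<in> K" "finite F" "F \<subseteq> U" "(\<epsilon>::real) > 0"
    then obtain y where y: "y \<in> D" "\<forall>\<beta>\<in>F. \<bar>\<kappa> \<beta> y - \<kappa> \<beta> x\<bar> < \<epsilon>" using approx by meson
    obtain i where i: "from_nat_into D i = y"
      using from_nat_into_surj[OF \<open>countable D\<close> y(1)] by blast
    show "frequently (\<lambda>n. \<forall>\<beta>\<in>F. \<bar>\<kappa> \<beta> (q n) - \<kappa> \<beta> x\<bar> < \<epsilon>) sequentially"
      unfolding frequently_sequentially
    proof
      fix N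
      have "N \<le> prod_encode (i, N)" by (rule le_prod_encode_2)
      moreover have "q (prod_encode (i, N)) = y" by (simp add: q_def i)
      ultimately show "\<exists>n\<ge>N. \<forall>\<beta>\<in>F. \<bar>\<kappa> \<beta> (q n) - \<kappa> \<beta> x\<bar> < \<epsilon>" using y(2) by metis
    qed
  qed
qed

lemma asymptotically_constant_tendsto:
  fixes g :: "nat \<Rightarrow> real"
  assumes "asymptotically_constant g P" "\<And>n. (n, r n) \<in> P"
  shows "(\<lambda>n. g n - g (r n)) \<longlonglongrightarrow> 0"
proof (rule LIMSEQ_I)
  fix \<epsilon> :: real assume "\<epsilon> > 0"
  let ?B = "fst ` (P - {(u,v). \<bar>g u - g v\<bar> < \<epsilon>})"
  have "finite ?B" using assms(1) \<open>\<epsilon> > 0\<close> by (simp add: asymptotically_constant_def)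
  then obtain N where N: "\<And>n. n \<in> ?B \<Longrightarrow> n < N" by (meson finite_nat_set_iff_bounded)
  show "\<exists>no. \<forall>n\<ge>no. norm (g n - g (r n) - 0) < \<epsilon>"
  proof (intro exI[of _ N] allI impI)
    fix n assume "n \<ge> N"
    then have "n \<notin> ?B" using N by (meson not_le)
    then have "(n, r n) \<notin> P - {(u,v). \<bar>g u - g v\<bar> < \<epsilon>}" by (metis fst_conv image_eqI)
    then show "norm (g n - g (r n) - 0) < \<epsilon>" using assms(2)[of n] by simp
  qed
qed

text \<open>Since the classes are finite, least representatives tend to infinity; functions on \<open>\<nat>\<close> may thus be
  transported to functions constant on classes without losing their behaviour at infinity.\<close>

lemma equiv_representatives:
  fixes P :: "(nat \<times> nat) set"
  assumes P: "equiv UNIV P" and fin: "\<And>x. finite (P `` {x})"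
  shows "\<exists>r. (\<forall>n. (n, r n) \<in> P) \<and> (\<forall>u v. (u,v) \<in> P \<longrightarrow> r u = r v) \<and>
    (\<forall>n. r (r n) = r n) \<and> filterlim r at_top sequentially"
proof -
  have Pr: "(x,x) \<in> P" for x using P by (auto simp: equiv_def refl_on_def)
  have Ps: "(y,x) \<in> P" if "(x,y) \<in> P" for x y using P that by (auto simp: equiv_def dest: symD)
  have Pt: "(x,z) \<in> P" if "(x,y) \<in> P" "(y,z) \<in> P" for x y z using P that by (meson equivE transD)
  define r where "r n = (LEAST m. (n,m) \<in> P)" for n
  have 1: "(n, r n) \<in> P" for n unfolding r_def using Pr by (rule LeastI)
  have 2: "r u = r v" if "(u,v) \<in> P" for u v
  proof -
    have "(u,m) \<in> P \<longleftrightarrow> (v,m) \<in> P" for m using that Ps Pt by blast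
    then show ?thesis by (simp add: r_def)
  qed
  have 3: "r (r n) = r n" for n using 1 2 by metis
  have "filterlim r at_top sequentially"
    unfolding filterlim_at_top
  proof
    fix N
    have "finite (P `` {..<N})" using fin by (subst Image_eq_UN) auto
    then obtain M where M: "\<And>n. n \<in> P `` {..<N} \<Longrightarrow> n < M" by (meson finite_nat_set_iff_bounded)
    have "N \<le> r n" if "n \<ge> M" for n
    proof (rule ccontr)
      assume "\<not> N \<le> r n"
      then have "n \<in> P `` {..<N}" using 1[of n] Ps by (intro ImageI[of "r n"]) auto
      then show False using M that by fastforce
    qed
    then show "eventually (\<lambda>n. N \<le> r n) sequentially" by (auto simp: eventually_sequentially)
  qed
  then show ?thesis using 1 2 3 by blast
qed

section \<open>The inductive step: a new function and a new relation\<close>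

lemma eventually_finite_tendsto:
  assumes "finite F" "\<And>\<beta>. \<beta> \<in> F \<Longrightarrow> (\<lambda>n. h \<beta> n) \<longlonglongrightarrow> (0::real)" "\<epsilon> > 0"
  shows "eventually (\<lambda>n. \<forall>\<beta>\<in>F. \<bar>h \<beta> n\<bar> < \<epsilon>) sequentially"
proof (rule eventually_ball_finite[OF assms(1)], rule ballI)
  fix \<beta> assume "\<beta> \<in> F"
  then show "eventually (\<lambda>n. \<bar>h \<beta> n\<bar> < \<epsilon>) sequentially"
    using tendstoD[OF assms(2) assms(3)] by simp
qed

lemma tendsto_approximations:
  fixes f :: "'i \<Rightarrow> nat \<Rightarrow> real" and \<kappa> :: "'i \<Rightarrow> 'a \<Rightarrow> real"
  assumes "K \<noteq> {}" "countable U"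
    and near: "\<And>F \<epsilon>. finite F \<Longrightarrow> F \<subseteq> U \<Longrightarrow> \<epsilon> > 0 \<Longrightarrow>
      eventually (\<lambda>n. \<exists>x\<in>K. \<forall>\<beta>\<in>F. \<bar>f \<beta> n - \<kappa> \<beta> x\<bar> < \<epsilon>) sequentially"
  shows "\<exists>p. range p \<subseteq> K \<and> (\<forall>\<beta>\<in>U. (\<lambda>n. f \<beta> n - \<kappa> \<beta> (p n)) \<longlonglongrightarrow> 0)"
proof -
  obtain F :: "nat \<Rightarrow> 'i set" where "\<forall>i. finite (F i)" "\<forall>i j. i \<le> j \<longrightarrow> F i \<subseteq> F j" "(\<Union>i. F i) = U"
    using countable_exhaustion[OF \<open>countable U\<close>] by (elim exE conjE)
  note F = this[rule_format]
  let ?Q = "\<lambda>i n x. \<forall>\<beta>\<in>F i. \<bar>f \<beta> n - \<kappa> \<beta> x\<bar> < inverse (real (Suc i))"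
  have ev: "eventually (\<lambda>n. \<exists>x\<in>K. \<forall>j\<le>i. ?Q j n x) sequentially" for i
  proof (rule eventually_mono)
    show "eventually (\<lambda>n. \<exists>x\<in>K. ?Q i n x) sequentially"
      using F by (intro near) auto
    fix n assume "\<exists>x\<in>K. ?Q i n x"
    then obtain x where x: "x \<in> K" "?Q i n x" by blast
    have "?Q j n x" if "j \<le> i" for j
    proof
      fix \<beta> assume "\<beta> \<in> F j"
      then have "\<bar>f \<beta> n - \<kappa> \<beta> x\<bar> < inverse (real (Suc i))" using x(2) F(2)[OF that] by blast
      also have "\<dots> \<le> inverse (real (Suc j))" using that by (simp add: field_simps)
      finally show "\<bar>f \<beta> n - \<kappa> \<beta> x\<bar> < inverse (real (Suc j))" .
    qed
    then show "\<exists>x\<in>K. \<forall>j\<le>i. ?Q j n x" using x(1) by blast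
  qed
  obtain p where "range p \<subseteq> K" "\<forall>i. eventually (\<lambda>n. ?Q i n (p n)) sequentially"
    using diagonal_choice[OF \<open>K \<noteq> {}\<close> ev] by (elim exE conjE)
  note p = this[rule_format]
  have "(\<lambda>n. f \<beta> n - \<kappa> \<beta> (p n)) \<longlonglongrightarrow> 0" if \<beta>: "\<beta> \<in> U" for \<beta>
  proof (rule tendstoI)
    fix \<epsilon> :: real assume "\<epsilon> > 0"
    then obtain i where i: "inverse (real (Suc i)) < \<epsilon>" using reals_Archimedean by blast
    obtain j where j: "\<beta> \<in> F j" using \<beta> F(3) by blast
    have "\<beta> \<in> F (max i j)" using j F(2)[of j "max i j"] by auto
    have "inverse (real (Suc (max i j))) \<le> inverse (real (Suc i))" by (simp add: field_simps)
    then have le: "inverse (real (Suc (max i j))) < \<epsilon>" using i by linarith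
    show "eventually (\<lambda>n. dist (f \<beta> n - \<kappa> \<beta> (p n)) 0 < \<epsilon>) sequentially"
      using p(2)[of "max i j"]
    proof eventually_elim
      case (elim n)
      then show ?case using \<open>\<beta> \<in> F (max i j)\<close> le by (auto simp del: of_nat_Suc intro: order_less_trans)
    qed
  qed
  then show ?thesis using p(1) by blast
qed

text \<open>The functions \<open>f \<beta>\<close>, \<open>\<beta> \<in> U\<close>, describe a map from \<open>\<nat>\<close> to a metrizable cube whose cluster points are
  precisely the points \<open>(\<kappa> \<beta> x)\<close>, \<open>x \<in> K\<close>.  Approximating points \<open>p n\<close> of \<open>K\<close> exist, and \<open>\<kappa> \<alpha> (p n)\<close>
  is a possible new coordinate.  For all points of \<open>K\<close> to remain cluster points after the new coordinate is
  added, \<open>p\<close> is redefined along a sparse sequence so as to visit a countable dense set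
  infinitely often.  Composing with representatives makes \<open>p\<close> constant on classes of \<open>P\<close>; the sparse
  sequence is therefore taken among the representatives.\<close>

lemma new_coordinate:
  fixes f :: "'i \<Rightarrow> nat \<Rightarrow> real" and \<kappa> :: "'i \<Rightarrow> 'a \<Rightarrow> real" and P :: "(nat \<times> nat) set"
  assumes "K \<noteq> {}" "countable U"
    and P: "equiv UNIV P" and fin: "\<And>x. finite (P `` {x})"
    and const: "\<And>\<beta>. \<beta> \<in> U \<Longrightarrow> asymptotically_constant (f \<beta>) P"
    and near: "\<And>F \<epsilon>. finite F \<Longrightarrow> F \<subseteq> U \<Longrightarrow> \<epsilon> > 0 \<Longrightarrow>
      eventually (\<lambda>n. \<exists>x\<in>K. \<forall>\<beta>\<in>F. \<bar>f \<beta> n - \<kappa> \<beta> x\<bar> < \<epsilon>) sequentially"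
    and freq: "\<And>x F \<epsilon>. x \<in> K \<Longrightarrow> finite F \<Longrightarrow> F \<subseteq> U \<Longrightarrow> \<epsilon> > 0 \<Longrightarrow>
      frequently (\<lambda>n. \<forall>\<beta>\<in>F. \<bar>f \<beta> n - \<kappa> \<beta> x\<bar> < \<epsilon>) sequentially"
  shows "\<exists>p. range p \<subseteq> K \<and> (\<forall>u v. (u,v) \<in> P \<longrightarrow> p u = p v) \<and>
    (\<forall>\<beta>\<in>U. (\<lambda>n. f \<beta> n - \<kappa> \<beta> (p n)) \<longlonglongrightarrow> 0) \<and>
    (\<forall>x F \<epsilon>. x \<in> K \<and> finite F \<and> F \<subseteq> insert \<alpha> U \<and> \<epsilon> > 0 \<longrightarrow>
      frequently (\<lambda>n. \<forall>\<beta>\<in>F. \<bar>\<kappa> \<beta> (p n) - \<kappa> \<beta> x\<bar> < \<epsilon>) sequentially)"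
proof -
  obtain r where "\<forall>n. (n, r n) \<in> P" "\<forall>u v. (u,v) \<in> P \<longrightarrow> r u = r v"
    "\<forall>n. r (r n) = r n" "filterlim r at_top sequentially"
    using equiv_representatives[OF P fin] by (elim exE conjE)
  note r = this[rule_format]
  have "\<exists>p. range p \<subseteq> K \<and> (\<forall>\<beta>\<in>U. (\<lambda>n. f \<beta> n - \<kappa> \<beta> (p n)) \<longlonglongrightarrow> 0)"
    by (rule tendsto_approximations[OF assms(1,2)]) (rule near)
  then obtain p0 where "range p0 \<subseteq> K" "\<forall>\<beta>\<in>U. (\<lambda>n. f \<beta> n - \<kappa> \<beta> (p0 n)) \<longlonglongrightarrow> 0"
    by (elim exE conjE)
  note p0 = this[rule_format]
  obtain q where "range q \<subseteq> K"
    "\<forall>x F \<epsilon>. x \<in> K \<and> finite F \<and> F \<subseteq> insert \<alpha> U \<and> \<epsilon> > 0 \<longrightarrow>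
       frequently (\<lambda>n. \<forall>\<beta>\<in>F. \<bar>\<kappa> \<beta> (q n) - \<kappa> \<beta> x\<bar> < \<epsilon>) sequentially"
    using dense_sequence[OF \<open>K \<noteq> {}\<close> countable_insert[OF \<open>countable U\<close>], of \<alpha> \<kappa>]
    by (elim exE conjE)
  note q = this(1) this(2)[rule_format, OF conjI[OF _ conjI[OF _ conjI]]]
  obtain F :: "nat \<Rightarrow> 'i set" where "\<forall>i. finite (F i)" "\<forall>i j. i \<le> j \<longrightarrow> F i \<subseteq> F j" "(\<Union>i. F i) = U"
    using countable_exhaustion[OF \<open>countable U\<close>] by (elim exE conjE)
  note F = this[rule_format]
  let ?Q = "\<lambda>i n. n \<in> range r \<and> (\<forall>\<beta>\<in>F i. \<bar>f \<beta> n - \<kappa> \<beta> (q i)\<bar> < inverse (real (Suc i)))"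
  have ex: "\<exists>n>N. ?Q i n" for i N
  proof -
    let ?e = "inverse (real (Suc i)) / 2"
    have e: "?e > 0" by simp
    have q': "\<exists>\<^sub>F n in sequentially. \<forall>\<beta>\<in>F i. \<bar>f \<beta> n - \<kappa> \<beta> (q i)\<bar> < ?e"
      using q(1) F e by (intro freq) auto
    have r': "\<forall>\<^sub>F n in sequentially. \<forall>\<beta>\<in>F i. \<bar>f \<beta> n - f \<beta> (r n)\<bar> < ?e"
      using F e by (intro eventually_finite_tendsto asymptotically_constant_tendsto[OF const r(1)]) auto
    have N': "\<forall>\<^sub>F n in sequentially. r n > N"
      using filterlim_at_top[of r sequentially, THEN iffD1, OF r(4), rule_format, of "Suc N"]
      by (simp add: Suc_le_eq)
    have "\<exists>\<^sub>F n in sequentially. (\<forall>\<beta>\<in>F i. \<bar>f \<beta> n - \<kappa> \<beta> (q i)\<bar> < ?e) \<and>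
       (\<forall>\<beta>\<in>F i. \<bar>f \<beta> n - f \<beta> (r n)\<bar> < ?e) \<and> r n > N"
      by (rule frequently_eventually_frequently[OF q' eventually_conj[OF r' N']])
    then obtain n where n: "\<forall>\<beta>\<in>F i. \<bar>f \<beta> n - \<kappa> \<beta> (q i)\<bar> < ?e"
       "\<forall>\<beta>\<in>F i. \<bar>f \<beta> n - f \<beta> (r n)\<bar> < ?e" "r n > N"
      using frequently_ex by blast
    have "\<bar>f \<beta> (r n) - \<kappa> \<beta> (q i)\<bar> < inverse (real (Suc i))" if "\<beta> \<in> F i" for \<beta>
      using n(1,2)[rule_format, OF that] by argo
    then show ?thesis using n(3) by blast
  qed
  obtain m where m: "strict_mono m" "\<forall>i. ?Q i (m i)"
    using strict_mono_choice[of ?Q, OF ex] by (elim exE conjE)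
  define p1 where "p1 n = (if n \<in> range m then q (inv m n) else p0 n)" for n
  have p1m: "p1 (m i) = q i" for i
    using m(1) by (simp add: p1_def strict_mono_imp_inj_on inv_f_f)
  have p1K: "p1 n \<in> K" for n using q(1) p0(1) by (auto simp: p1_def)
  have p1: "(\<lambda>n. f \<beta> n - \<kappa> \<beta> (p1 n)) \<longlonglongrightarrow> 0" if \<beta>: "\<beta> \<in> U" for \<beta>
  proof (rule tendstoI)
    fix \<epsilon> :: real assume "\<epsilon> > 0"
    then obtain i where i: "inverse (real (Suc i)) < \<epsilon>" using reals_Archimedean by blast
    obtain j where j: "\<beta> \<in> F j" using \<beta> F(3) by blast
    have "\<bar>f \<beta> (m k) - \<kappa> \<beta> (q k)\<bar> < \<epsilon>" if "k \<ge> i" "k \<ge> j" for k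
    proof -
      have "\<beta> \<in> F k" using j F(2)[OF that(2)] by blast
      then have "\<bar>f \<beta> (m k) - \<kappa> \<beta> (q k)\<bar> < inverse (real (Suc k))" using m(2) by blast
      also have "\<dots> \<le> inverse (real (Suc i))" using that by (simp add: field_simps)
      finally show ?thesis using i by linarith
    qed
    then have mk: "\<bar>f \<beta> (m k) - \<kappa> \<beta> (q k)\<bar> < \<epsilon>" if "m k \<ge> m (max i j)" for k
      using that m(1) by (simp add: strict_mono_less_eq)
    show "\<forall>\<^sub>F n in sequentially. dist (f \<beta> n - \<kappa> \<beta> (p1 n)) 0 < \<epsilon>"
      using tendstoD[OF p0(2)[OF \<beta>] \<open>\<epsilon> > 0\<close>] eventually_ge_at_top[of "m (max i j)"]
    proof eventually_elim
      case (elim n)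
      show ?case
      proof (cases "n \<in> range m")
        case True
        then obtain k where "n = m k" by blast
        then show ?thesis using mk[of k] elim(2) by (simp add: p1m)
      next
        case False
        then show ?thesis using elim(1) by (simp add: p1_def)
      qed
    qed
  qed
  let ?p = "\<lambda>n. p1 (r n)"
  show ?thesis
  proof (intro exI[of _ ?p] conjI allI impI ballI; (elim conjE)?)
    show "range ?p \<subseteq> K" using p1K by auto
    show "?p u = ?p v" if "(u,v) \<in> P" for u v using r(2)[OF that] by simp
    show "(\<lambda>n. f \<beta> n - \<kappa> \<beta> (?p n)) \<longlonglongrightarrow> 0" if "\<beta> \<in> U" for \<beta>
    proof -
      have "(\<lambda>n. (f \<beta> n - f \<beta> (r n)) + (f \<beta> (r n) - \<kappa> \<beta> (p1 (r n)))) \<longlonglongrightarrow> 0 + 0"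
        by (intro tendsto_add asymptotically_constant_tendsto[OF const[OF that] r(1)]
            filterlim_compose[OF p1[OF that] r(4)])
      then show ?thesis by simp
    qed
    fix x G \<epsilon> assume *: "x \<in> K" "finite G" "G \<subseteq> insert \<alpha> U" "(\<epsilon>::real) > 0"
    show "\<exists>\<^sub>F n in sequentially. \<forall>\<beta>\<in>G. \<bar>\<kappa> \<beta> (?p n) - \<kappa> \<beta> x\<bar> < \<epsilon>"
      unfolding frequently_sequentially
    proof
      fix N
      obtain i where i: "i \<ge> N" "\<forall>\<beta>\<in>G. \<bar>\<kappa> \<beta> (q i) - \<kappa> \<beta> x\<bar> < \<epsilon>"
        using q(2)[OF *] unfolding frequently_sequentially by blast
      have "m i \<ge> N" using i(1) seq_suble[OF m(1), of i] by linarith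
      moreover have "r (m i) = m i" using m(2)[rule_format, of i] r(3) by auto
      ultimately show "\<exists>n\<ge>N. \<forall>\<beta>\<in>G. \<bar>\<kappa> \<beta> (?p n) - \<kappa> \<beta> x\<bar> < \<epsilon>"
        using i(2) by (intro exI[of _ "m i"]) (simp add: p1m)
    qed
  qed
qed

text \<open>The closures of \<open>A\<close> and \<open>B\<close> in the compactification given by \<open>f \<beta>\<close>, \<open>\<beta> \<in> U\<close>, have no common point
  at infinity.\<close>

definition separated :: "('i \<Rightarrow> nat \<Rightarrow> real) \<Rightarrow> 'i set \<Rightarrow> nat set \<Rightarrow> nat set \<Rightarrow> bool"
  where "separated f U A B \<longleftrightarrow> (\<exists>F \<epsilon> N. finite F \<and> F \<subseteq> U \<and> \<epsilon> > 0 \<and>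
    (\<forall>u\<in>A. \<forall>v\<in>B. u > N \<and> v > N \<longrightarrow> (\<exists>\<beta>\<in>F. \<bar>f \<beta> u - f \<beta> v\<bar> \<ge> \<epsilon>)))"

text \<open>If the closures of \<open>A\<close> and \<open>B\<close> meet at infinity, choose pairs \<open>(x i, y i)\<close> in \<open>A \<times> B\<close> whose images
  approach each other, each pair so far out that none of its points is \<open>P\<close>-equivalent to
  a point of an earlier pair.  The relation linking \<open>x i\<close> to \<open>y i\<close> is as required.\<close>

lemma link_sets:
  fixes f :: "'i \<Rightarrow> nat \<Rightarrow> real" and P :: "(nat \<times> nat) set"
  assumes "countable U" and P: "equiv UNIV P" and fin: "\<And>x. finite (P `` {x})"
    and "A \<inter> B = {}" and "\<not> separated f U A B"
  shows "\<exists>E. equiv UNIV E \<and> uniformly_finite E \<and> transversal E P \<and>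
    (\<forall>\<beta>\<in>U. asymptotically_constant (f \<beta>) E) \<and> infinite (E \<inter> A \<times> B)"
proof -
  have Pr: "(x,x) \<in> P" for x using P by (auto simp: equiv_def refl_on_def)
  have Ps: "(y,x) \<in> P" if "(x,y) \<in> P" for x y using P that by (auto simp: equiv_def dest: symD)
  obtain F :: "nat \<Rightarrow> 'i set" where "\<forall>i. finite (F i)" "\<forall>i j. i \<le> j \<longrightarrow> F i \<subseteq> F j" "(\<Union>i. F i) = U"
    using countable_exhaustion[OF \<open>countable U\<close>] by (elim exE conjE)
  note F = this[rule_format]
  \<comment> \<open>The number \<open>b k\<close> will strictly bound all points that are \<open>P\<close>-equivalent to some number \<open>\<le> k\<close>.\<close>
  have "\<exists>b. \<forall>x \<in> P `` {..k}. x < b" for k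
  proof -
    have "finite (P `` {..k})" using fin by (subst Image_eq_UN) auto
    then show ?thesis by (meson finite_nat_set_iff_bounded)
  qed
  then obtain b where b: "\<And>k x. x \<in> P `` {..k} \<Longrightarrow> x < b k" by metis
  have bP: "v < b k" if "(u,v) \<in> P" "u \<le> k" for u v k using that by (intro b ImageI) auto
  have bk: "k < b k" for k using bP[OF Pr] by simp
  have ex: "\<exists>u v. u \<in> A \<and> v \<in> B \<and> u > N \<and> v > N \<and> (\<forall>\<beta>\<in>F i. \<bar>f \<beta> u - f \<beta> v\<bar> < inverse (real (Suc i)))" for i N
  proof (rule ccontr)
    assume "\<not> ?thesis"
    then have "\<forall>u\<in>A. \<forall>v\<in>B. u > N \<and> v > N \<longrightarrow> (\<exists>\<beta>\<in>F i. \<bar>f \<beta> u - f \<beta> v\<bar> \<ge> inverse (real (Suc i)))"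
      by (meson not_le)
    moreover have "F i \<subseteq> U" using F(3) by blast
    ultimately have "separated f U A B"
      unfolding separated_def using F(1)[of i]
      by (intro exI[of _ "F i"] exI[of _ "inverse (real (Suc i))"] exI[of _ N]) simp
    then show False using assms(5) by blast
  qed
  let ?Q = "\<lambda>i z. fst z \<in> A \<and> snd z \<in> B \<and> (\<forall>\<beta>\<in>F i. \<bar>f \<beta> (fst z) - f \<beta> (snd z)\<bar> < inverse (real (Suc i)))"
  have "\<exists>z. \<forall>i. ?Q i (z i) \<and> (fst (z (Suc i)) > b (max (fst (z i)) (snd (z i))) \<and> snd (z (Suc i)) > b (max (fst (z i)) (snd (z i))))"
  proof (rule dependent_nat_choice)
    show "\<exists>z. ?Q 0 z" using ex[of 0 0] by auto
    fix z i
    show "\<exists>w. ?Q (Suc i) w \<and> (fst w > b (max (fst z) (snd z)) \<and> snd w > b (max (fst z) (snd z)))"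
      using ex[of "b (max (fst z) (snd z))" "Suc i"] by auto
  qed
  then obtain z where z: "\<And>i. ?Q i (z i)"
    "\<And>i. fst (z (Suc i)) > b (max (fst (z i)) (snd (z i)))"
    "\<And>i. snd (z (Suc i)) > b (max (fst (z i)) (snd (z i)))" by metis
  define x where "x i = fst (z i)" for i
  define y where "y i = snd (z i)" for i
  define M where "M i = max (x i) (y i)" for i
  have xA: "x i \<in> A" and yB: "y i \<in> B" for i using z(1)[of i] by (auto simp: x_def y_def)
  have xy: "x i \<noteq> y j" for i j using xA yB \<open>A \<inter> B = {}\<close> by (metis disjoint_iff)
  have step: "b (M i) < x (Suc i)" "b (M i) < y (Suc i)" for i
    using z(2,3)[of i] by (simp_all add: M_def x_def y_def)
  have Mstep: "M i < x (Suc i)" "M i < y (Suc i)" for i using step[of i] bk[of "M i"] by linarith+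
  have Mmono: "M i \<le> M j" if "i \<le> j" for i j
  proof (rule lift_Suc_mono_le[OF _ that])
    show "M n \<le> M (Suc n)" for n using Mstep[of n] unfolding M_def by linarith
  qed
  have sep0: "(s,t) \<notin> P" if ij: "i < j" and s: "s \<in> {x i, y i}" and t: "t \<in> {x j, y j}" for s t i j
  proof
    assume st: "(s,t) \<in> P"
    obtain k where k: "j = Suc k" "i \<le> k" using ij by (cases j) auto
    have "s \<le> M i" using s by (auto simp: M_def)
    then have "s \<le> M k" using Mmono[OF k(2)] by linarith
    then have "t < b (M k)" using bP[OF st] by blast
    then show False using step[of k] t k(1) by auto
  qed
  have sep: "i = j" if "s \<in> {x i, y i}" "t \<in> {x j, y j}" "(s,t) \<in> P" for s t i j
    using sep0[of i j s t] sep0[of j i t s] that Ps by (meson linorder_neqE_nat)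
  define E where "E = {(s,t). s = t \<or> (\<exists>i. s \<in> {x i, y i} \<and> t \<in> {x i, y i})}"
  have Eeq: "equiv UNIV E"
  proof (rule equivI)
    show "refl_on UNIV E" by (simp add: refl_on_def E_def)
    show "sym E" by (auto simp: sym_def E_def)
    show "trans E"
    proof (rule transI)
      fix s t u assume st: "(s,t) \<in> E" and tu: "(t,u) \<in> E"
      show "(s,u) \<in> E"
      proof (cases "s = t \<or> t = u")
        case False
        then obtain i j where ij: "s \<in> {x i, y i}" "t \<in> {x i, y i}" "t \<in> {x j, y j}" "u \<in> {x j, y j}"
          using st tu by (auto simp: E_def)
        then have "i = j" using sep[OF ij(2,3) Pr] by blast
        then show ?thesis using ij by (auto simp: E_def)
      qed (use st tu in auto)
    qed
  qed auto
  have Econv: "E\<inverse> = E" by (auto simp: E_def)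
  have "\<exists>T. finite T \<and> card T \<le> 3 \<and> E `` {s} \<subseteq> T" for s
  proof (cases "\<exists>i. s \<in> {x i, y i}")
    case True
    then obtain i where i: "s \<in> {x i, y i}" by blast
    have "E `` {s} \<subseteq> {s, x i, y i}"
    proof
      fix t assume "t \<in> E `` {s}"
      then consider "t = s" | j where "s \<in> {x j, y j}" "t \<in> {x j, y j}" by (auto simp: E_def)
      then show "t \<in> {s, x i, y i}"
      proof cases
        case (2 j)
        then show ?thesis using sep[OF i 2(1) Pr] by auto
      qed simp
    qed
    moreover have "card {s, x i, y i} \<le> 3" by (simp add: card_insert_if)
    ultimately show ?thesis by (intro exI[of _ "{s, x i, y i}"]) simp
  next
    case False
    then show ?thesis by (intro exI[of _ "{s}"]) (auto simp: E_def)
  qed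
  then have "finite (E `` {s}) \<and> card (E `` {s}) \<le> 3" for s
    by (meson card_mono finite_subset order_trans)
  then have "uniformly_finite E"
    unfolding uniformly_finite_def Econv bounded_fibres_def by blast
  moreover have "transversal E P"
    unfolding transversal_def
  proof (intro allI impI)
    fix s t assume *: "s \<in> Field (E - Id) \<and> t \<in> Field (E - Id) \<and> (s,t) \<in> P"
    then obtain i j where ij: "s \<in> {x i, y i}" "t \<in> {x j, y j}"
      by (auto simp: Field_def E_def)
    then have "i = j" using sep * by blast
    then show "(s,t) \<in> E" using ij by (auto simp: E_def)
  qed
  moreover have "asymptotically_constant (f \<beta>) E" if \<beta>: "\<beta> \<in> U" for \<beta>
    unfolding asymptotically_constant_def
  proof (intro allI impI)
    fix \<epsilon> :: real assume "\<epsilon> > 0"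
    then obtain i where i: "inverse (real (Suc i)) < \<epsilon>" using reals_Archimedean by blast
    obtain j where j: "\<beta> \<in> F j" using \<beta> F(3) by blast
    have small: "\<bar>f \<beta> (x k) - f \<beta> (y k)\<bar> < \<epsilon>" if "k \<ge> i" "k \<ge> j" for k
    proof -
      have "\<beta> \<in> F k" using j F(2)[OF that(2)] by blast
      then have "\<bar>f \<beta> (x k) - f \<beta> (y k)\<bar> < inverse (real (Suc k))" using z(1)[of k] by (simp add: x_def y_def)
      also have "\<dots> \<le> inverse (real (Suc i))" using that by (simp add: field_simps)
      finally show ?thesis using i by linarith
    qed
    have "E - {(u,v). \<bar>f \<beta> u - f \<beta> v\<bar> < \<epsilon>} \<subseteq> (\<Union>k\<le>max i j. {x k, y k} \<times> {x k, y k})"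
    proof (rule subrelI)
      fix s t assume "(s,t) \<in> E - {(u,v). \<bar>f \<beta> u - f \<beta> v\<bar> < \<epsilon>}"
      then have st: "(s,t) \<in> E" and big: "\<not> \<bar>f \<beta> s - f \<beta> t\<bar> < \<epsilon>" by auto
      have "s \<noteq> t" using big \<open>\<epsilon> > 0\<close> by auto
      then obtain k where k: "s \<in> {x k, y k}" "t \<in> {x k, y k}" using st by (auto simp: E_def)
      have "\<not> (k \<ge> i \<and> k \<ge> j)"
        using small[of k] big k \<open>\<epsilon> > 0\<close> by (auto simp: abs_minus_commute)
      then have "k \<le> max i j" by auto
      then show "(s,t) \<in> (\<Union>k\<le>max i j. {x k, y k} \<times> {x k, y k})" using k by blast
    qed
    then show "finite (E - {(u,v). \<bar>f \<beta> u - f \<beta> v\<bar> < \<epsilon>})" by (rule finite_subset) simp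
  qed
  moreover have "infinite (E \<inter> A \<times> B)"
  proof -
    have "inj (\<lambda>i. (x i, y i))"
    proof (rule injI)
      fix i j assume "(x i, y i) = (x j, y j)"
      then show "i = j" using sep[of "x i" i "x j" j] Pr by simp
    qed
    then have "infinite (range (\<lambda>i. (x i, y i)))" by (rule range_inj_infinite)
    moreover have "range (\<lambda>i. (x i, y i)) \<subseteq> E \<inter> A \<times> B" using xA yB by (auto simp: E_def)
    ultimately show ?thesis using finite_subset by blast
  qed
  ultimately show ?thesis using Eeq by blast
qed

section \<open>The transfinite recursion\<close>

lemma equiv_rtrancl_Union:
  assumes "\<And>i. i \<in> F \<Longrightarrow> equiv UNIV (E i)"
  shows "equiv UNIV ((\<Union>i\<in>F. E i)\<^sup>*)"
proof (rule equivI)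
  have "sym (\<Union>i\<in>F. E i)"
    using assms by (intro sym_UNION) (auto simp: equiv_def)
  then show "sym ((\<Union>i\<in>F. E i)\<^sup>*)" by (rule sym_rtrancl)
qed (auto intro: refl_rtrancl trans_rtrancl)

lemma equiv_contains_rtrancl:
  assumes "equiv UNIV J" "S \<subseteq> J" shows "S\<^sup>* \<subseteq> J"
proof -
  have "(x,y) \<in> J" if "(x,y) \<in> S\<^sup>*" for x y
    using that
  proof induction
    case base then show ?case using assms(1) by (auto simp: equiv_def refl_on_def)
  next
    case (step y z)
    then show ?case using assms by (meson equivE subsetD transD)
  qed
  then show ?thesis by auto
qed

text \<open>The index set is well-ordered by \<open>R\<close> with countable initial segments.  Stage \<open>\<alpha>\<close> realises the function
  \<open>\<kappa> \<alpha>\<close> and treats the pair of sets \<open>A \<alpha>\<close> and \<open>B \<alpha>\<close>.\<close>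

locale omega1_recursion =
  fixes R :: "('i \<times> 'i) set" and K :: "'a set" and \<kappa> :: "'i \<Rightarrow> 'a \<Rightarrow> real"
    and A B :: "'i \<Rightarrow> nat set"
  assumes wf: "wf R" and trans: "trans R"
    and total: "\<And>x y. x = y \<or> (x,y) \<in> R \<or> (y,x) \<in> R"
    and countable_below: "\<And>\<alpha>. countable {\<beta>. (\<beta>,\<alpha>) \<in> R}"
    and nonempty: "K \<noteq> {}" and in_unit_interval: "\<And>\<alpha> x. x \<in> K \<Longrightarrow> \<kappa> \<alpha> x \<in> {0..1}"
begin

definition below :: "'i \<Rightarrow> 'i set" where "below \<alpha> = {\<beta>. (\<beta>,\<alpha>) \<in> R}"

definition up_to :: "'i \<Rightarrow> 'i set" where "up_to \<alpha> = insert \<alpha> (below \<alpha>)"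

text \<open>The demands on stage \<open>\<alpha>\<close>; they refer only to the values of \<open>f\<close> and \<open>E\<close> up to \<open>\<alpha>\<close>, which makes the
  recursion possible.  Nothing is demanded of all finite joins: each property of finitely many stages follows
  from admissibility of the largest stage or by induction on the number of stages, so that
  successor and limit stages are treated alike.  Of the three last conditions, the first
  keeps all cluster points of the constructed sequence inside the image of \<open>K\<close> and the second makes
  every point of that image a cluster point.\<close>

definition admissible :: "('i \<Rightarrow> nat \<Rightarrow> real) \<Rightarrow> ('i \<Rightarrow> (nat \<times> nat) set) \<Rightarrow> 'i \<Rightarrow> bool"
  where "admissible f E \<alpha> \<longleftrightarrow>
    equiv UNIV (E \<alpha>) \<and> uniformly_finite (E \<alpha>) \<and>
    (\<exists>P. equiv UNIV P \<and> (\<forall>x. finite (P `` {x})) \<and> (\<forall>\<beta>\<in>below \<alpha>. finite (E \<beta> - P)) \<and> transversal (E \<alpha>) P) \<and>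
    range (f \<alpha>) \<subseteq> {0..1} \<and>
    (\<forall>\<beta>\<in>below \<alpha>. asymptotically_constant (f \<alpha>) (E \<beta>)) \<and>
    (\<forall>\<beta>\<in>up_to \<alpha>. asymptotically_constant (f \<beta>) (E \<alpha>)) \<and>
    (\<exists>p. range p \<subseteq> K \<and> (\<forall>\<beta>\<in>up_to \<alpha>. (\<lambda>n. f \<beta> n - \<kappa> \<beta> (p n)) \<longlonglongrightarrow> 0)) \<and>
    (\<forall>x F \<epsilon>. x \<in> K \<and> finite F \<and> F \<subseteq> up_to \<alpha> \<and> \<epsilon> > 0 \<longrightarrow>
      frequently (\<lambda>n. \<forall>\<beta>\<in>F. \<bar>f \<beta> n - \<kappa> \<beta> x\<bar> < \<epsilon>) sequentially) \<and>
    (A \<alpha> \<inter> B \<alpha> = {} \<longrightarrow> separated f (up_to \<alpha>) (A \<alpha>) (B \<alpha>) \<or> infinite (E \<alpha> \<inter> A \<alpha> \<times> B \<alpha>))"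

lemma separated_cong:
  assumes "\<And>\<beta>. \<beta> \<in> U \<Longrightarrow> f \<beta> = f' \<beta>"
  shows "separated f U S T \<longleftrightarrow> separated f' U S T"
proof -
  have *: "(\<exists>\<beta>\<in>F. \<bar>f \<beta> u - f \<beta> v\<bar> \<ge> \<epsilon>) \<longleftrightarrow> (\<exists>\<beta>\<in>F. \<bar>f' \<beta> u - f' \<beta> v\<bar> \<ge> \<epsilon>)" if "F \<subseteq> U" for F u v \<epsilon>
    using that assms by (metis subsetD)
  show ?thesis unfolding separated_def
    by (intro ex_cong1 conj_cong refl ball_cong imp_cong *)
qed

lemma admissible_cong:
  assumes fE: "\<And>\<beta>. \<beta> \<in> up_to \<alpha> \<Longrightarrow> f \<beta> = f' \<beta> \<and> E \<beta> = E' \<beta>"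
  shows "admissible f E \<alpha> \<longleftrightarrow> admissible f' E' \<alpha>"
proof -
  have 1: "f \<alpha> = f' \<alpha>" "E \<alpha> = E' \<alpha>" and 2: "\<And>\<beta>. \<beta> \<in> below \<alpha> \<Longrightarrow> E \<beta> = E' \<beta>"
    and 3: "\<And>\<beta>. \<beta> \<in> up_to \<alpha> \<Longrightarrow> f \<beta> = f' \<beta>"
    using fE by (auto simp: up_to_def)
  have 4: "(\<forall>\<beta>\<in>F. \<bar>f \<beta> n - \<kappa> \<beta> x\<bar> < \<epsilon>) \<longleftrightarrow> (\<forall>\<beta>\<in>F. \<bar>f' \<beta> n - \<kappa> \<beta> x\<bar> < \<epsilon>)" if "F \<subseteq> up_to \<alpha>" for F n x \<epsilon>
    using that 3 by (metis subsetD)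
  have 5: "separated f (up_to \<alpha>) (A \<alpha>) (B \<alpha>) \<longleftrightarrow> separated f' (up_to \<alpha>) (A \<alpha>) (B \<alpha>)"
    using 3 by (rule separated_cong)
  have 6: "frequently (\<lambda>n. \<forall>\<beta>\<in>F. \<bar>f \<beta> n - \<kappa> \<beta> x\<bar> < \<epsilon>) sequentially \<longleftrightarrow>
      frequently (\<lambda>n. \<forall>\<beta>\<in>F. \<bar>f' \<beta> n - \<kappa> \<beta> x\<bar> < \<epsilon>) sequentially" if "F \<subseteq> up_to \<alpha>" for F x \<epsilon>
    unfolding 4[OF that] ..
  have 7: "(\<forall>x F \<epsilon>. x \<in> K \<and> finite F \<and> F \<subseteq> up_to \<alpha> \<and> \<epsilon> > 0 \<longrightarrow>
      frequently (\<lambda>n. \<forall>\<beta>\<in>F. \<bar>f \<beta> n - \<kappa> \<beta> x\<bar> < \<epsilon>) sequentially) \<longleftrightarrow>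
     (\<forall>x F \<epsilon>. x \<in> K \<and> finite F \<and> F \<subseteq> up_to \<alpha> \<and> \<epsilon> > 0 \<longrightarrow>
      frequently (\<lambda>n. \<forall>\<beta>\<in>F. \<bar>f' \<beta> n - \<kappa> \<beta> x\<bar> < \<epsilon>) sequentially)"
    using 6 by (intro iff_allI imp_cong refl) blast
  show ?thesis
    unfolding admissible_def 7 5 by (simp add: 1 2 3 cong: ball_cong conj_cong)
qed

lemma finite_has_max:
  assumes "finite F" "F \<noteq> {}" shows "\<exists>m\<in>F. F \<subseteq> up_to m"
  using assms
proof (induction rule: finite_ne_induct)
  case (singleton x) then show ?case by (simp add: up_to_def)
next
  case (insert x F)
  then obtain m where m: "m \<in> F" "F \<subseteq> up_to m" by blast
  show ?case
  proof (cases "(m,x) \<in> R")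
    case True
    have "up_to m \<subseteq> up_to x"
      using True trans by (auto simp: up_to_def below_def dest: transD)
    then show ?thesis using m by (auto simp: up_to_def)
  next
    case False
    then have "x \<in> up_to m" using total[of m x] by (auto simp: up_to_def below_def)
    then show ?thesis using m by blast
  qed
qed

lemma below_irrefl: "\<alpha> \<notin> below \<alpha>"
  using wf by (simp add: below_def)

text \<open>Induction on the number of relations, splitting off the one of largest index \<open>m\<close>: the join of the others
  lies in a word, so it is almost contained in the relation \<open>P\<close> to which \<open>E m\<close> is transversal.\<close>

lemma finite_join:
  assumes "finite F" "\<forall>i\<in>F. admissible f E i" "finite C"
  shows "\<exists>J W. equiv UNIV J \<and> (\<forall>i\<in>F. E i \<subseteq> J) \<and> C \<times> C \<subseteq> J \<and> J \<subseteq> W \<and> W \<in> words E F"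
  using assms
proof (induction "card F" arbitrary: F C)
  case 0
  then have "F = {}" by simp
  moreover have "equiv UNIV (Id \<union> C \<times> C)"
    by (rule equivI) (auto simp: refl_on_def sym_def trans_def)
  ultimately show ?case
    using words.square[OF \<open>finite C\<close>, of E F] by (intro exI[of _ "Id \<union> C \<times> C"]) auto
next
  case (Suc k)
  then have "F \<noteq> {}" by auto
  then obtain m where m: "m \<in> F" "F \<subseteq> up_to m" using finite_has_max Suc.prems(1) by blast
  define F' where "F' = F - {m}"
  have F': "F = insert m F'" "F' \<subseteq> below m" "card F' = k" "finite F'"
    using m Suc by (auto simp: F'_def up_to_def)
  have "\<forall>i\<in>F'. admissible f E i" using F'(1) Suc.prems(2) by blast
  from Suc.hyps(1)[OF F'(3)[symmetric] F'(4) this \<open>finite C\<close>] obtain J W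
    where J: "equiv UNIV J" "\<forall>i\<in>F'. E i \<subseteq> J" "C \<times> C \<subseteq> J" and W: "J \<subseteq> W" "W \<in> words E F'"
    by (elim exE conjE)
  have gm: "admissible f E m" using Suc.prems(2) m(1) by blast
  then have Em: "equiv UNIV (E m)" "uniformly_finite (E m)" by (simp_all add: admissible_def)
  from gm have "\<exists>P. equiv UNIV P \<and> (\<forall>x. finite (P `` {x})) \<and> (\<forall>\<beta>\<in>below m. finite (E \<beta> - P)) \<and> transversal (E m) P"
    by (simp only: admissible_def)
  then obtain P where P: "equiv UNIV P" "\<forall>x. finite (P `` {x})"
    "\<forall>\<beta>\<in>below m. finite (E \<beta> - P)" "transversal (E m) P" by (elim exE conjE)
  have uf: "uniformly_finite (E i)" if "i \<in> F'" for i
    using that F'(1) Suc.prems(2) by (simp add: admissible_def)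
  have "finite (W - P)"
    by (rule words_almost_subset_equiv[OF W(2) uf P(1)]) (use P(3) F'(2) in auto)
  then have JP: "finite (J - P)" by (rule finite_subset[rotated]) (use W(1) in blast)
  obtain D where D: "finite D" "C \<subseteq> D" "equiv UNIV (J O E m O J \<union> D \<times> D)"
    by (rule join_transversal[OF J(1) P(1) Em(1) P(2)[rule_format] uniformly_finiteD(1)[OF Em(2)] JP P(4) \<open>finite C\<close>])
  have Jr: "(x,x) \<in> J" and Er: "(x,x) \<in> E m" for x
    using J(1) Em(1) by (auto simp: equiv_def refl_on_def)
  let ?J = "J O E m O J \<union> D \<times> D" and ?W = "W O E m O W O (Id \<union> D \<times> D)"
  have EW: "E m \<subseteq> J O E m O J"
    by (rule subrelI) (rule relcompI[OF Jr relcompI[OF _ Jr]])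
  have JW: "J \<subseteq> J O E m O J"
    by (rule subrelI) (rule relcompI[OF _ relcompI[OF Er Jr]])
  have "\<forall>i\<in>F. E i \<subseteq> ?J"
  proof
    fix i assume "i \<in> F"
    then consider "i = m" | "i \<in> F'" using F'(1) by blast
    then show "E i \<subseteq> ?J"
    proof cases
      case 1 then show ?thesis using EW by (simp add: le_supI1)
    next
      case 2 then have "E i \<subseteq> J" using J(2) by blast
      then show ?thesis using JW by (meson le_supI1 order_trans)
    qed
  qed
  moreover have "C \<times> C \<subseteq> ?J" using D(2) by blast
  moreover have "?J \<subseteq> ?W" using W(1) Jr Er by blast
  moreover have "?W \<in> words E F"
  proof -
    have "W \<in> words E F" using W(2) words_mono[of F' F E] F'(1) by blast
    then show ?thesis
      using words.gen[of m F E] m(1) words.square[OF D(1)] by (intro words.comp)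
  qed
  ultimately show ?case using D(3) by blast
qed

text \<open>Admissibility controls \<open>f \<beta>\<close> along earlier and simultaneous relations directly, and along a later
  relation \<open>E \<gamma>\<close> through the admissibility of \<open>\<gamma>\<close>.\<close>

lemma asymptotically_constant_admissible:
  assumes "admissible f E \<beta>" "admissible f E \<gamma>" shows "asymptotically_constant (f \<beta>) (E \<gamma>)"
proof -
  consider "\<gamma> \<in> below \<beta>" | "\<beta> \<in> up_to \<gamma>"
    using total[of \<beta> \<gamma>] by (auto simp: below_def up_to_def)
  then show ?thesis using assms by cases (simp_all add: admissible_def)
qed

lemma near_admissible:
  assumes "finite F" "\<And>i. i \<in> F \<Longrightarrow> admissible f E i" "\<epsilon> > 0"
  shows "eventually (\<lambda>n. \<exists>x\<in>K. \<forall>\<beta>\<in>F. \<bar>f \<beta> n - \<kappa> \<beta> x\<bar> < \<epsilon>) sequentially"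
proof (cases "F = {}")
  case True then show ?thesis using nonempty by auto
next
  case False
  then obtain m where m: "m \<in> F" "F \<subseteq> up_to m" using finite_has_max assms(1) by blast
  have "\<exists>p. range p \<subseteq> K \<and> (\<forall>\<beta>\<in>up_to m. (\<lambda>n. f \<beta> n - \<kappa> \<beta> (p n)) \<longlonglongrightarrow> 0)"
    using assms(2)[OF m(1)] by (simp only: admissible_def)
  then obtain p where p: "range p \<subseteq> K" "\<forall>\<beta>\<in>up_to m. (\<lambda>n. f \<beta> n - \<kappa> \<beta> (p n)) \<longlonglongrightarrow> 0"
    by (elim exE conjE)
  have "eventually (\<lambda>n. \<forall>\<beta>\<in>F. \<bar>f \<beta> n - \<kappa> \<beta> (p n)\<bar> < \<epsilon>) sequentially"
    using m(2) p(2) assms by (intro eventually_finite_tendsto) auto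
  then show ?thesis by (rule eventually_mono) (use p(1) in blast)
qed

lemma frequently_admissible:
  assumes "finite F" "\<And>i. i \<in> F \<Longrightarrow> admissible f E i" "\<epsilon> > 0" "x \<in> K"
  shows "frequently (\<lambda>n. \<forall>\<beta>\<in>F. \<bar>f \<beta> n - \<kappa> \<beta> x\<bar> < \<epsilon>) sequentially"
proof (cases "F = {}")
  case False
  then obtain m where m: "m \<in> F" "F \<subseteq> up_to m" using finite_has_max assms(1) by blast
  have "\<forall>x F \<epsilon>. x \<in> K \<and> finite F \<and> F \<subseteq> up_to m \<and> \<epsilon> > 0 \<longrightarrow>
      frequently (\<lambda>n. \<forall>\<beta>\<in>F. \<bar>f \<beta> n - \<kappa> \<beta> x\<bar> < \<epsilon>) sequentially"
    using assms(2)[OF m(1)] unfolding admissible_def by (elim conjE)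
  then show ?thesis using assms m(2) by blast
qed simp

lemma uniformly_finite_Id: "uniformly_finite Id"
  using uniformly_finite_Id_Un_square[of "{}"] by simp

text \<open>The relations \<open>T i\<close> are the joins of an increasing sequence of finite sets of earlier
  relations, and \<open>Q i\<close> collects the pairs at which finitely many earlier functions differ little.\<close>

lemma extend_admissible:
  assumes admissible_below: "\<forall>\<beta>\<in>below \<alpha>. admissible f E \<beta>"
  shows "\<exists>g S. admissible (f(\<alpha> := g)) (E(\<alpha> := S)) \<alpha>"
proof -
  let ?U = "below \<alpha>"
  have cU: "countable ?U" using countable_below by (simp add: below_def)
  have uf: "uniformly_finite (E \<beta>)" and eqE: "equiv UNIV (E \<beta>)" if "\<beta> \<in> ?U" for \<beta>
    using admissible_below that by (simp_all add: admissible_def)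
  obtain F :: "nat \<Rightarrow> 'i set" where "\<forall>i. finite (F i)" "\<forall>i j. i \<le> j \<longrightarrow> F i \<subseteq> F j" "(\<Union>i. F i) = ?U"
    using countable_exhaustion[OF cU] by (elim exE conjE)
  note F = this[rule_format]
  have FU: "F i \<subseteq> ?U" for i using F(3) by blast
  define T where "T i = (\<Union>\<beta>\<in>F i. E \<beta>)\<^sup>*" for i
  define Q where "Q i = {(u,v). \<forall>\<beta>\<in>F i. \<bar>f \<beta> u - f \<beta> v\<bar> < inverse (real (Suc i))}" for i
  have TW: "\<exists>W. T i \<subseteq> W \<and> W \<in> words E ?U" for i
  proof -
    have "\<forall>\<beta>\<in>F i. admissible f E \<beta>" using FU assms by blast
    from finite_join[OF F(1) this finite.emptyI] obtain J W
      where "equiv UNIV J" "\<forall>\<beta>\<in>F i. E \<beta> \<subseteq> J" "J \<subseteq> W" "W \<in> words E (F i)" by (elim exE conjE)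
    moreover from this have "T i \<subseteq> J" unfolding T_def by (intro equiv_contains_rtrancl) auto
    moreover have "words E (F i) \<subseteq> words E ?U" using FU by (rule words_mono)
    ultimately show ?thesis by blast
  qed
  have ufT: "uniformly_finite (T i)" for i
  proof -
    obtain W where "T i \<subseteq> W" "W \<in> words E ?U" using TW by blast
    then show ?thesis using words_uniformly_finite[where E=E and U="?U", OF _ uf] uniformly_finite_subset by blast
  qed
  have acT: "asymptotically_constant (f \<beta>) (T i)" if "\<beta> \<in> ?U" for \<beta> i
  proof -
    obtain W where "T i \<subseteq> W" "W \<in> words E ?U" using TW by blast
    moreover from this(2) have "asymptotically_constant (f \<beta>) W"
      by (rule words_asymptotically_constant)
        (use uf asymptotically_constant_admissible assms that in blast)+
    ultimately show ?thesis using asymptotically_constant_subset by blast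
  qed
  have "\<exists>P. equiv UNIV P \<and> (\<forall>x. finite (P `` {x})) \<and>
    (\<forall>i. finite (T i - P)) \<and> (\<forall>i. finite (P - Q i))"
  proof (rule coarsening[of T Q])
    show "equiv UNIV (T i)" for i
      unfolding T_def using eqE FU by (intro equiv_rtrancl_Union) blast
    show "finite (T i `` {x})" for i x using uniformly_finiteD(1)[OF ufT] .
    show "T i \<subseteq> T j" if "i \<le> j" for i j
      unfolding T_def using F(2)[OF that] by (intro rtrancl_mono) blast
    show "Q j \<subseteq> Q i" if "i \<le> j" for i j
    proof -
      have "inverse (real (Suc j)) \<le> inverse (real (Suc i))" using that by (simp add: field_simps)
      then have "\<bar>f \<beta> u - f \<beta> v\<bar> < inverse (real (Suc i))"
        if "\<bar>f \<beta> u - f \<beta> v\<bar> < inverse (real (Suc j))" for \<beta> u v using that by linarith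
      then show ?thesis unfolding Q_def using F(2)[OF that] by blast
    qed
    show "finite (T i - Q i)" for i
    proof (rule finite_subset)
      show "T i - Q i \<subseteq> (\<Union>\<beta>\<in>F i. T i - {(u,v). \<bar>f \<beta> u - f \<beta> v\<bar> < inverse (real (Suc i))})"
        unfolding Q_def by blast
      have "finite (T i - {(u,v). \<bar>f \<beta> u - f \<beta> v\<bar> < inverse (real (Suc i))})" if "\<beta> \<in> F i" for \<beta>
      proof -
        have "\<beta> \<in> ?U" using FU that by blast
        from acT[OF this, of i] show ?thesis
          unfolding asymptotically_constant_def by simp
      qed
      then show "finite (\<Union>\<beta>\<in>F i. T i - {(u,v). \<bar>f \<beta> u - f \<beta> v\<bar> < inverse (real (Suc i))})"
        using F(1) by blast
    qed
  qed
  then obtain P where "equiv UNIV P" "\<forall>x. finite (P `` {x})"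
    "\<forall>i. finite (T i - P)" "\<forall>i. finite (P - Q i)" by (elim exE conjE)
  note P = this(1) this(2-4)[rule_format]
  have EP: "finite (E \<beta> - P)" if \<beta>: "\<beta> \<in> ?U" for \<beta>
  proof -
    obtain i where "\<beta> \<in> F i" using \<beta> F(3) by blast
    then have "E \<beta> \<subseteq> T i" unfolding T_def by auto
    then show ?thesis using P(3)[of i] by (meson Diff_mono finite_subset order_refl)
  qed
  have acP: "asymptotically_constant (f \<beta>) P" if \<beta>: "\<beta> \<in> ?U" for \<beta>
    unfolding asymptotically_constant_def
  proof (intro allI impI)
    fix \<epsilon> :: real assume "\<epsilon> > 0"
    then obtain i where i: "inverse (real (Suc i)) < \<epsilon>" using reals_Archimedean by blast
    obtain j where j: "\<beta> \<in> F j" using \<beta> F(3) by blast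
    let ?k = "max i j"
    have "\<beta> \<in> F ?k" using j F(2)[of j ?k] by auto
    moreover have "inverse (real (Suc ?k)) \<le> inverse (real (Suc i))" by (simp add: field_simps)
    then have "inverse (real (Suc ?k)) < \<epsilon>" using i by linarith
    then have "\<bar>f \<beta> u - f \<beta> v\<bar> < \<epsilon>"
      if "\<bar>f \<beta> u - f \<beta> v\<bar> < inverse (real (Suc ?k))" for u v using that by linarith
    ultimately have "Q ?k \<subseteq> {(u,v). \<bar>f \<beta> u - f \<beta> v\<bar> < \<epsilon>}"
      unfolding Q_def by blast
    then show "finite (P - {(u,v). \<bar>f \<beta> u - f \<beta> v\<bar> < \<epsilon>})"
      using P(4)[of ?k] by (meson Diff_mono finite_subset order_refl)
  qed
  have "\<exists>p. range p \<subseteq> K \<and> (\<forall>u v. (u,v) \<in> P \<longrightarrow> p u = p v) \<and>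
    (\<forall>\<beta>\<in>?U. (\<lambda>n. f \<beta> n - \<kappa> \<beta> (p n)) \<longlonglongrightarrow> 0) \<and>
    (\<forall>x F \<epsilon>. x \<in> K \<and> finite F \<and> F \<subseteq> insert \<alpha> ?U \<and> \<epsilon> > 0 \<longrightarrow>
      frequently (\<lambda>n. \<forall>\<beta>\<in>F. \<bar>\<kappa> \<beta> (p n) - \<kappa> \<beta> x\<bar> < \<epsilon>) sequentially)"
  proof (rule new_coordinate[OF nonempty cU P(1,2)])
    fix G :: "'i set" and \<epsilon> :: real
    assume G: "finite G" "G \<subseteq> ?U" "\<epsilon> > 0"
    then have gG: "admissible f E i" if "i \<in> G" for i using that assms by blast
    show "\<forall>\<^sub>F n in sequentially. \<exists>x\<in>K. \<forall>\<beta>\<in>G. \<bar>f \<beta> n - \<kappa> \<beta> x\<bar> < \<epsilon>"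
      using G(1) gG G(3) by (rule near_admissible)
    show "\<exists>\<^sub>F n in sequentially. \<forall>\<beta>\<in>G. \<bar>f \<beta> n - \<kappa> \<beta> x\<bar> < \<epsilon>" if "x \<in> K" for x
      using G(1) gG G(3) that by (rule frequently_admissible)
  qed (use acP in blast)
  then obtain p where "range p \<subseteq> K" "\<forall>u v. (u,v) \<in> P \<longrightarrow> p u = p v"
    "\<forall>\<beta>\<in>?U. (\<lambda>n. f \<beta> n - \<kappa> \<beta> (p n)) \<longlonglongrightarrow> 0"
    "\<forall>x F \<epsilon>. x \<in> K \<and> finite F \<and> F \<subseteq> insert \<alpha> ?U \<and> \<epsilon> > 0 \<longrightarrow>
      frequently (\<lambda>n. \<forall>\<beta>\<in>F. \<bar>\<kappa> \<beta> (p n) - \<kappa> \<beta> x\<bar> < \<epsilon>) sequentially"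
    by (elim exE conjE)
  note p = this(1) this(2-4)[rule_format]
  define g where "g n = \<kappa> \<alpha> (p n)" for n
  define f' where "f' = f(\<alpha> := g)"
  have f'\<alpha>: "f' \<alpha> = g" and f'U: "\<And>\<beta>. \<beta> \<in> ?U \<Longrightarrow> f' \<beta> = f \<beta>"
    using below_irrefl[of \<alpha>] by (auto simp: f'_def)
  have near: "(\<lambda>n. f' \<beta> n - \<kappa> \<beta> (p n)) \<longlonglongrightarrow> 0" if "\<beta> \<in> up_to \<alpha>" for \<beta>
    using that p(3) by (auto simp: up_to_def f'\<alpha> f'U g_def)
  have freq: "\<exists>\<^sub>F n in sequentially. \<forall>\<beta>\<in>G. \<bar>f' \<beta> n - \<kappa> \<beta> x\<bar> < \<epsilon>"
    if "x \<in> K" "finite G" "G \<subseteq> up_to \<alpha>" "\<epsilon> > 0" for x G \<epsilon>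
  proof -
    have a: "\<exists>\<^sub>F n in sequentially. \<forall>\<beta>\<in>G. \<bar>\<kappa> \<beta> (p n) - \<kappa> \<beta> x\<bar> < \<epsilon>/2"
      using that by (intro p(4)) (auto simp: up_to_def)
    have b: "\<forall>\<^sub>F n in sequentially. \<forall>\<beta>\<in>G. \<bar>f' \<beta> n - \<kappa> \<beta> (p n)\<bar> < \<epsilon>/2"
      using that near by (intro eventually_finite_tendsto) auto
    show ?thesis
    proof (rule frequently_elim1[OF frequently_eventually_frequently[OF a b]], rule ballI)
      fix n \<beta> assume *: "(\<forall>\<beta>\<in>G. \<bar>\<kappa> \<beta> (p n) - \<kappa> \<beta> x\<bar> < \<epsilon>/2) \<and> (\<forall>\<beta>\<in>G. \<bar>f' \<beta> n - \<kappa> \<beta> (p n)\<bar> < \<epsilon>/2)"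
        and "\<beta> \<in> G"
      then have "\<bar>\<kappa> \<beta> (p n) - \<kappa> \<beta> x\<bar> < \<epsilon>/2" "\<bar>f' \<beta> n - \<kappa> \<beta> (p n)\<bar> < \<epsilon>/2" by blast+
      then show "\<bar>f' \<beta> n - \<kappa> \<beta> x\<bar> < \<epsilon>" by argo
    qed
  qed
  have acgP: "asymptotically_constant g P"
  proof -
    have "P - {(u,v). \<bar>g u - g v\<bar> < \<epsilon>} = {}" if "\<epsilon> > 0" for \<epsilon>
      using p(2) that by (auto simp: g_def)
    then show ?thesis unfolding asymptotically_constant_def by (metis finite.emptyI)
  qed
  have range_g: "range g \<subseteq> {0..1}" using in_unit_interval p(1) unfolding g_def by blast
  have "\<exists>S. equiv UNIV S \<and> uniformly_finite S \<and> transversal S P \<and>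
    (\<forall>\<beta>\<in>up_to \<alpha>. asymptotically_constant (f' \<beta>) S) \<and>
    (A \<alpha> \<inter> B \<alpha> = {} \<longrightarrow> separated f' (up_to \<alpha>) (A \<alpha>) (B \<alpha>) \<or> infinite (S \<inter> A \<alpha> \<times> B \<alpha>))"
  proof (cases "A \<alpha> \<inter> B \<alpha> = {} \<and> \<not> separated f' (up_to \<alpha>) (A \<alpha>) (B \<alpha>)")
    case True
    have "countable (up_to \<alpha>)" using cU by (simp add: up_to_def)
    then show ?thesis using link_sets[OF _ P(1,2), of "up_to \<alpha>" "A \<alpha>" "B \<alpha>" f'] True by blast
  next
    case False
    have "equiv UNIV (Id :: nat rel)" by (rule equivI) (auto simp: refl_on_def sym_def trans_def)
    moreover have "transversal Id P" by (simp add: transversal_def)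
    moreover have "asymptotically_constant h Id" for h :: "nat \<Rightarrow> real"
      unfolding asymptotically_constant_def
    proof (intro allI impI)
      fix \<epsilon> :: real assume "\<epsilon> > 0"
      then have "Id - {(u,v). \<bar>h u - h v\<bar> < \<epsilon>} = {}" by auto
      then show "finite (Id - {(u,v). \<bar>h u - h v\<bar> < \<epsilon>})" by (simp only: finite.emptyI)
    qed
    ultimately show ?thesis using False uniformly_finite_Id by blast
  qed
  then obtain S where S: "equiv UNIV S" "uniformly_finite S" "transversal S P"
    "\<forall>\<beta>\<in>up_to \<alpha>. asymptotically_constant (f' \<beta>) S"
    "A \<alpha> \<inter> B \<alpha> = {} \<longrightarrow> separated f' (up_to \<alpha>) (A \<alpha>) (B \<alpha>) \<or> infinite (S \<inter> A \<alpha> \<times> B \<alpha>)"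
    by (elim exE conjE)
  define E' where "E' = E(\<alpha> := S)"
  have E'\<alpha>: "E' \<alpha> = S" and E'U: "\<And>\<beta>. \<beta> \<in> ?U \<Longrightarrow> E' \<beta> = E \<beta>"
    using below_irrefl[of \<alpha>] by (auto simp: E'_def)
  have "asymptotically_constant (f' \<alpha>) (E' \<beta>)" if "\<beta> \<in> ?U" for \<beta>
    using asymptotically_constant_almost_subset[OF acgP EP[OF that]] by (simp add: f'\<alpha> E'U[OF that])
  moreover have "\<exists>P. equiv UNIV P \<and> (\<forall>x. finite (P `` {x})) \<and> (\<forall>\<beta>\<in>?U. finite (E' \<beta> - P)) \<and> transversal (E' \<alpha>) P"
    using P(1,2) EP S(3) by (intro exI[of _ P]) (simp add: E'\<alpha> E'U)
  moreover have "\<exists>p. range p \<subseteq> K \<and> (\<forall>\<beta>\<in>up_to \<alpha>. (\<lambda>n. f' \<beta> n - \<kappa> \<beta> (p n)) \<longlonglongrightarrow> 0)"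
    using p(1) near by blast
  moreover have "\<forall>x F \<epsilon>. x \<in> K \<and> finite F \<and> F \<subseteq> up_to \<alpha> \<and> \<epsilon> > 0 \<longrightarrow>
      frequently (\<lambda>n. \<forall>\<beta>\<in>F. \<bar>f' \<beta> n - \<kappa> \<beta> x\<bar> < \<epsilon>) sequentially"
    using freq by blast
  ultimately have "admissible f' E' \<alpha>"
    unfolding admissible_def E'\<alpha> using S range_g f'\<alpha> by (intro conjI) (assumption | simp)+
  then show ?thesis unfolding f'_def E'_def by blast
qed

lemma all_admissible: "\<exists>f E. \<forall>\<alpha>. admissible f E \<alpha>"
proof -
  let ?P = "\<lambda>G x r. admissible ((\<lambda>i. fst (G i))(x := fst r)) ((\<lambda>i. snd (G i))(x := snd r)) x"
  have "\<exists>G. \<forall>x. ?P G x (G x)"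
  proof (rule dependent_wf_choice[OF wf])
    fix G H :: "'i \<Rightarrow> (nat \<Rightarrow> real) \<times> (nat \<times> nat) set" and x r
    assume "\<And>z. (z, x) \<in> R \<Longrightarrow> G z = H z"
    then show "?P G x r = ?P H x r"
      by (intro admissible_cong) (auto simp: up_to_def below_def)
  next
    fix x and G :: "'i \<Rightarrow> (nat \<Rightarrow> real) \<times> (nat \<times> nat) set"
    assume G: "\<And>y. (y, x) \<in> R \<Longrightarrow> ?P G y (G y)"
    have "\<forall>y\<in>below x. admissible (\<lambda>i. fst (G i)) (\<lambda>i. snd (G i)) y"
      using G by (simp add: below_def fun_upd_idem)
    from extend_admissible[OF this] obtain g S
      where "admissible ((\<lambda>i. fst (G i))(x := g)) ((\<lambda>i. snd (G i))(x := S)) x" by (elim exE)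
    then show "\<exists>r. ?P G x r" by (intro exI[of _ "(g, S)"]) simp
  qed
  then obtain G where "\<And>x. ?P G x (G x)" by blast
  then have "admissible (\<lambda>i. fst (G i)) (\<lambda>i. snd (G i)) x" for x by (simp add: fun_upd_idem)
  then show ?thesis by blast
qed

end

section \<open>The coarse structure\<close>

locale corona_construction = omega1_recursion R "topspace X" \<kappa> A B
  for R :: "('i \<times> 'i) set" and X :: "'a topology" and \<kappa> :: "'i \<Rightarrow> 'a \<Rightarrow> real"
    and A B :: "'i \<Rightarrow> nat set" +
  fixes f :: "'i \<Rightarrow> nat \<Rightarrow> real" and E :: "'i \<Rightarrow> (nat \<times> nat) set"
  assumes compact: "compact_space X"
    and continuous: "\<And>\<alpha>. continuous_map X euclideanreal (\<kappa> \<alpha>)"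
    and separating: "\<And>x y. x \<in> topspace X \<Longrightarrow> y \<in> topspace X \<Longrightarrow> x \<noteq> y \<Longrightarrow> \<exists>\<alpha>. \<kappa> \<alpha> x \<noteq> \<kappa> \<alpha> y"
    and all_pairs: "\<And>S T. \<exists>\<alpha>. A \<alpha> = S \<and> B \<alpha> = T"
    and admissible: "\<And>\<alpha>. admissible f E \<alpha>"
begin

abbreviation W :: "(nat \<times> nat) set set" where "W \<equiv> words E UNIV"

definition coarse :: "(nat \<times> nat) set set"
  where "coarse = {S. Id \<subseteq> S \<and> (\<exists>V\<in>W. S \<subseteq> V)}"

lemma W_uniformly_finite: "V \<in> W \<Longrightarrow> uniformly_finite V"
  by (erule words_uniformly_finite) (use admissible in \<open>simp add: admissible_def\<close>)

lemma W_subset_equiv: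
  assumes "V \<in> W" shows "\<exists>J. equiv UNIV J \<and> V \<subseteq> J \<and> (\<exists>V'\<in>W. J \<subseteq> V')"
proof -
  obtain F C where FC: "finite F" "finite C"
    and V: "\<forall>J. equiv UNIV J \<and> (\<forall>i\<in>F. E i \<subseteq> J) \<and> C \<times> C \<subseteq> J \<longrightarrow> V \<subseteq> J"
    using words_subset_equiv[OF assms] by (elim exE conjE)
  have "\<forall>i\<in>F. admissible f E i" using admissible by blast
  from finite_join[OF FC(1) this FC(2)] obtain J V'
    where J: "equiv UNIV J" "\<forall>i\<in>F. E i \<subseteq> J" "C \<times> C \<subseteq> J" "J \<subseteq> V'" "V' \<in> words E F"
    by (elim exE conjE)
  have "V \<subseteq> J" using V J(1-3) by blast
  moreover have "V' \<in> W" using J(5) words_mono[of F UNIV E] by blast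
  ultimately show ?thesis using J(1,4) by blast
qed

lemma coarseI: "Id \<subseteq> S \<Longrightarrow> S \<subseteq> V \<Longrightarrow> V \<in> W \<Longrightarrow> S \<in> coarse"
  unfolding coarse_def by blast

lemma coarseE:
  assumes "S \<in> coarse" obtains V where "Id \<subseteq> S" "V \<in> W" "S \<subseteq> V"
  using assms unfolding coarse_def by blast

lemma square_in_coarse: "finite C \<Longrightarrow> Id \<union> C \<times> C \<in> coarse"
  by (rule coarseI[OF _ order_refl words.square]) simp_all

lemma coarse_space_coarse: "coarse_space UNIV coarse"
  unfolding coarse_space_def
proof (intro conjI ballI allI impI)
  show "entourage UNIV S" if "S \<in> coarse" for S
    using that by (rule coarseE) (auto simp: entourage_def)
  show "\<Union>coarse = UNIV \<times> UNIV"
  proof (intro equalityI subsetI)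
    fix z :: "nat \<times> nat"
    have "Id \<union> {fst z, snd z} \<times> {fst z, snd z} \<in> coarse"
      by (rule square_in_coarse) simp
    then show "z \<in> \<Union>coarse" by (rule UnionI) (simp add: mem_Times_iff)
  qed simp
  show "\<exists>G\<in>coarse. S O T\<inverse> \<subseteq> G" if S: "S \<in> coarse" and T: "T \<in> coarse" for S T
  proof -
    obtain V where V: "Id \<subseteq> S" "V \<in> W" "S \<subseteq> V" using S by (rule coarseE)
    obtain V' where V': "V' \<in> W" "T \<subseteq> V'" using T by (rule coarseE)
    obtain J V'' where J: "equiv UNIV J" "V' \<subseteq> J" "V'' \<in> W" "J \<subseteq> V''"
      using W_subset_equiv[OF V'(1)] by (elim exE conjE bexE)
    have "sym J" using J(1) by (simp add: equiv_def)
    moreover have "T \<subseteq> J" using V'(2) J(2) by (rule order_trans)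
    ultimately have "T\<inverse> \<subseteq> V''" using J(4) by (auto dest: symD)
    then have "S O T\<inverse> \<subseteq> V O V''" using V(3) by (rule relcomp_mono[rotated])
    moreover have "Id O Id \<subseteq> V O V''"
    proof (rule relcomp_mono)
      show "Id \<subseteq> V" using V(1,3) by (rule order_trans)
      show "Id \<subseteq> V''" using J(1,4) by (auto simp: equiv_def refl_on_def)
    qed
    then have "V O V'' \<in> coarse"
      by (intro coarseI[OF _ order_refl words.comp[OF V(2) J(3)]]) simp
    ultimately show ?thesis by (intro bexI)
  qed
  show "S \<in> coarse" if "Id_on UNIV \<subseteq> S \<and> S \<subseteq> T \<and> T \<in> coarse" for S T
  proof -
    from that have "T \<in> coarse" by blast
    then obtain V where "V \<in> W" "T \<subseteq> V" by (rule coarseE)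
    moreover have "Id \<subseteq> S" using that by (auto simp: Id_on_def)
    ultimately show ?thesis using that by (meson coarseI order_trans)
  qed
qed

lemma cellular_coarse: "cellular UNIV coarse"
  unfolding cellular_def
proof
  fix S assume "S \<in> coarse"
  then obtain V where V: "V \<in> W" "S \<subseteq> V" by (rule coarseE)
  obtain J V' where J: "equiv UNIV J" "V \<subseteq> J" "V' \<in> W" "J \<subseteq> V'"
    using W_subset_equiv[OF V(1)] by (elim exE conjE bexE)
  have "Id \<subseteq> J" using J(1) by (auto simp: equiv_def refl_on_def)
  then have "J \<in> coarse" using J(3,4) by (intro coarseI)
  moreover have "S \<subseteq> J" using V(2) J(2) by (rule order_trans)
  ultimately show "\<exists>J\<in>coarse. S \<subseteq> J \<and> equiv UNIV J" using J(1) by (intro bexI conjI)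
qed

lemma coarse_uniformly_finite: "S \<in> coarse \<Longrightarrow> uniformly_finite S"
  by (erule coarseE) (rule uniformly_finite_subset[OF W_uniformly_finite])

lemma finitary_coarse: "finitary UNIV coarse"
  unfolding finitary_def
proof
  fix S assume "S \<in> coarse"
  then have "bounded_fibres S" using coarse_uniformly_finite by (simp add: uniformly_finite_def)
  then show "\<exists>n. \<forall>x\<in>UNIV. finite (S `` {x}) \<and> card (S `` {x}) \<le> n"
    by (simp add: bounded_fibres_def)
qed

lemma coarsely_bounded_iff: "coarsely_bounded UNIV coarse S \<longleftrightarrow> finite S"
proof
  assume "coarsely_bounded UNIV coarse S"
  then obtain T x where "T \<in> coarse" "S \<subseteq> T `` {x}" by (auto simp: coarsely_bounded_def)
  then show "finite S"
    using uniformly_finiteD(1)[OF coarse_uniformly_finite] finite_subset by blast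
next
  assume "finite S"
  let ?T = "Id \<union> insert 0 S \<times> insert 0 S"
  have "?T \<in> coarse" using \<open>finite S\<close> by (intro square_in_coarse) simp
  moreover have "S \<subseteq> ?T `` {0}" by auto
  ultimately show "coarsely_bounded UNIV coarse S"
    unfolding coarsely_bounded_def by blast
qed

lemma slowly_oscillatingI:
  assumes "\<And>V. V \<in> W \<Longrightarrow> asymptotically_constant \<phi> V"
  shows "slowly_oscillating UNIV coarse \<phi>"
  unfolding slowly_oscillating_def
proof (intro allI impI ballI)
  fix \<epsilon> :: real and S assume "\<epsilon> > 0" and S: "S \<in> coarse"
  obtain V where V: "V \<in> W" "S \<subseteq> V" using S by (rule coarseE)
  let ?D = "fst ` (V - {(u,v). \<bar>\<phi> u - \<phi> v\<bar> < \<epsilon>/3})"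
  have "finite ?D"
    using \<open>\<epsilon> > 0\<close> by (intro finite_imageI asymptotically_constantD[OF assms[OF V(1)]]) simp
  moreover have "bounded (\<phi> ` (S `` {x})) \<and> diameter (\<phi> ` (S `` {x})) < \<epsilon>" if "x \<in> UNIV - ?D" for x
  proof
    show "bounded (\<phi> ` (S `` {x}))"
      using uniformly_finiteD(1)[OF coarse_uniformly_finite[OF S]] by (intro finite_imp_bounded) simp
    have near: "\<bar>\<phi> x - \<phi> u\<bar> < \<epsilon>/3" if "u \<in> S `` {x}" for u
    proof (rule ccontr)
      assume "\<not> ?thesis"
      then have "(x,u) \<in> V - {(u,v). \<bar>\<phi> u - \<phi> v\<bar> < \<epsilon>/3}" using that V(2) by auto
      then have "x \<in> ?D" by (metis fst_conv image_eqI)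
      then show False using \<open>x \<in> UNIV - ?D\<close> by blast
    qed
    have "diameter (\<phi> ` (S `` {x})) \<le> 2 * (\<epsilon>/3)"
    proof (rule diameter_le)
      show "\<phi> ` (S `` {x}) \<noteq> {} \<or> 0 \<le> 2 * (\<epsilon>/3)" using \<open>\<epsilon> > 0\<close> by simp
      fix s t assume "s \<in> \<phi> ` (S `` {x})" "t \<in> \<phi> ` (S `` {x})"
      then obtain u v where uv: "s = \<phi> u" "t = \<phi> v" "u \<in> S `` {x}" "v \<in> S `` {x}" by blast
      show "norm (s - t) \<le> 2 * (\<epsilon>/3)"
        using near[OF uv(3)] near[OF uv(4)] unfolding uv(1,2) real_norm_def by argo
    qed
    then show "diameter (\<phi> ` (S `` {x})) < \<epsilon>" using \<open>\<epsilon> > 0\<close> by simp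
  qed
  ultimately show "\<exists>D. coarsely_bounded UNIV coarse D \<and>
      (\<forall>x\<in>UNIV - D. bounded (\<phi> ` (S `` {x})) \<and> diameter (\<phi> ` (S `` {x})) < \<epsilon>)"
    using coarsely_bounded_iff by blast
qed

text \<open>The pair of sets \<open>{\<phi> \<le> a}\<close> and \<open>{\<phi> \<ge> b}\<close> was treated at some stage.  Infinitely many links between
  them would contradict slow oscillation along the relation of that stage.\<close>

lemma slowly_oscillating_separated:
  assumes so: "slowly_oscillating UNIV coarse \<phi>" and "a < b"
  obtains F \<epsilon> N where "finite F" "\<epsilon> > 0"
    "\<forall>u v. \<phi> u \<le> a \<and> \<phi> v \<ge> b \<and> u > N \<and> v > N \<longrightarrow> (\<exists>\<beta>\<in>F. \<bar>f \<beta> u - f \<beta> v\<bar> \<ge> \<epsilon>)"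
proof -
  obtain \<alpha> where \<alpha>: "A \<alpha> = {u. \<phi> u \<le> a}" "B \<alpha> = {v. \<phi> v \<ge> b}" using all_pairs by blast
  have "A \<alpha> \<inter> B \<alpha> = {}" using \<open>a < b\<close> by (auto simp: \<alpha>)
  then have dich: "separated f (up_to \<alpha>) (A \<alpha>) (B \<alpha>) \<or> infinite (E \<alpha> \<inter> A \<alpha> \<times> B \<alpha>)"
    using admissible[of \<alpha>] unfolding admissible_def by blast
  have "equiv UNIV (E \<alpha>)" and uf: "uniformly_finite (E \<alpha>)" using admissible[of \<alpha>] by (simp_all add: admissible_def)
  then have refl: "(u,u) \<in> E \<alpha>" for u by (auto simp: equiv_def refl_on_def)
  then have "Id \<subseteq> E \<alpha>" by auto
  then have "E \<alpha> \<in> coarse" by (rule coarseI[OF _ order_refl words.gen[OF UNIV_I]])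
  moreover have "b - a > 0" using \<open>a < b\<close> by simp
  ultimately obtain D where D: "coarsely_bounded UNIV coarse D"
    "\<forall>x\<in>UNIV - D. bounded (\<phi> ` (E \<alpha> `` {x})) \<and> diameter (\<phi> ` (E \<alpha> `` {x})) < b - a"
    using so unfolding slowly_oscillating_def by meson
  have "E \<alpha> \<inter> A \<alpha> \<times> B \<alpha> \<subseteq> (SIGMA u : D. E \<alpha> `` {u})"
  proof (rule subrelI)
    fix u v assume uv: "(u,v) \<in> E \<alpha> \<inter> A \<alpha> \<times> B \<alpha>"
    have "u \<in> D"
    proof (rule ccontr)
      assume "u \<notin> D"
      then have "bounded (\<phi> ` (E \<alpha> `` {u}))" "diameter (\<phi> ` (E \<alpha> `` {u})) < b - a" using D(2) by auto
      moreover have "\<phi> u \<in> \<phi> ` (E \<alpha> `` {u})" "\<phi> v \<in> \<phi> ` (E \<alpha> `` {u})" using refl uv by auto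
      ultimately have "dist (\<phi> u) (\<phi> v) < b - a" using diameter_bounded_bound by (meson order_le_less_trans)
      moreover have "\<phi> u \<le> a" "\<phi> v \<ge> b" using uv by (auto simp: \<alpha>)
      ultimately show False by (simp add: dist_real_def)
    qed
    then show "(u,v) \<in> (SIGMA u : D. E \<alpha> `` {u})" using uv by auto
  qed
  moreover have "finite (SIGMA u : D. E \<alpha> `` {u})"
    using D(1) uniformly_finiteD(1)[OF uf] by (auto simp: coarsely_bounded_iff)
  ultimately have "separated f (up_to \<alpha>) (A \<alpha>) (B \<alpha>)" using dich finite_subset by blast
  then obtain F \<epsilon> N where 1: "finite F" "\<epsilon> > 0"
    "\<forall>u\<in>A \<alpha>. \<forall>v\<in>B \<alpha>. u > N \<and> v > N \<longrightarrow> (\<exists>\<beta>\<in>F. \<bar>f \<beta> u - f \<beta> v\<bar> \<ge> \<epsilon>)"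
    unfolding separated_def by (elim exE conjE)
  have "\<forall>u v. \<phi> u \<le> a \<and> \<phi> v \<ge> b \<and> u > N \<and> v > N \<longrightarrow> (\<exists>\<beta>\<in>F. \<bar>f \<beta> u - f \<beta> v\<bar> \<ge> \<epsilon>)"
    using 1(3) by (simp add: \<alpha>)
  then show ?thesis by (rule that[OF 1(1,2)])
qed

section \<open>Limits of slowly oscillating functions at the points of the given space\<close>

abbreviation SO :: "(nat \<Rightarrow> real) set" where "SO \<equiv> so_functions UNIV coarse"

lemma SO_iff: "\<phi> \<in> SO \<longleftrightarrow> bounded (range \<phi>) \<and> slowly_oscillating UNIV coarse \<phi>"
  by (simp add: so_functions_def)

lemma f_in_SO: "f \<beta> \<in> SO"
proof -
  have "range (f \<beta>) \<subseteq> {0..1}" using admissible[of \<beta>] by (simp add: admissible_def)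
  then have "bounded (range (f \<beta>))" using bounded_closed_interval bounded_subset by metis
  moreover have "asymptotically_constant (f \<beta>) V" if "V \<in> W" for V
  proof (rule words_asymptotically_constant[OF that])
    show "uniformly_finite (E i)" for i using admissible[of i] by (simp add: admissible_def)
    show "asymptotically_constant (f \<beta>) (E i)" for i by (rule asymptotically_constant_admissible[OF admissible admissible])
  qed
  ultimately show ?thesis using slowly_oscillatingI SO_iff by blast
qed

text \<open>These functions distinguish points of the corona from the points of \<open>\<nat>\<close>.\<close>

lemma indicator_in_SO: "indicator {m} \<in> SO"
proof -
  have "bounded (range (indicator {m} :: nat \<Rightarrow> real))"
    by (rule bounded_subset[of "{0,1}"]) (auto simp: indicator_def)
  moreover have "asymptotically_constant (indicator {m}) V" if "V \<in> W" for V
    unfolding asymptotically_constant_def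
  proof (intro allI impI)
    fix \<epsilon> :: real assume "\<epsilon> > 0"
    have "V - {(u,v). \<bar>indicator {m} u - indicator {m} v\<bar> < \<epsilon>} \<subseteq> {m} \<times> V `` {m} \<union> V\<inverse> `` {m} \<times> {m}"
      using \<open>\<epsilon> > 0\<close> by (auto simp: indicator_def split: if_splits)
    moreover have "finite ({m} \<times> V `` {m} \<union> V\<inverse> `` {m} \<times> {m})"
      using uniformly_finiteD[OF W_uniformly_finite[OF that]] by blast
    ultimately show "finite (V - {(u,v). \<bar>indicator {m} u - indicator {m} v\<bar> < \<epsilon>})"
      by (rule finite_subset)
  qed
  ultimately show ?thesis using slowly_oscillatingI SO_iff by blast
qed

text \<open>These sets are the traces on \<open>\<nat>\<close> of a neighbourhood base of \<open>x\<close> in the compactification of \<open>\<nat>\<close>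
  determined by the functions \<open>f \<beta>\<close>.  They form a filter base; convergence along it is convergence to \<open>x\<close>.\<close>

definition nb :: "'a \<Rightarrow> 'i set \<Rightarrow> real \<Rightarrow> nat \<Rightarrow> nat set"
  where "nb x F \<epsilon> N = {n. n > N \<and> (\<forall>\<beta>\<in>F. \<bar>f \<beta> n - \<kappa> \<beta> x\<bar> < \<epsilon>)}"

lemma nb_nonempty:
  assumes "x \<in> topspace X" "finite F" "\<epsilon> > 0" shows "nb x F \<epsilon> N \<noteq> {}"
proof -
  have "frequently (\<lambda>n. \<forall>\<beta>\<in>F. \<bar>f \<beta> n - \<kappa> \<beta> x\<bar> < \<epsilon>) sequentially"
    by (rule frequently_admissible[OF assms(2) admissible assms(3,1)])
  then obtain n where "n \<ge> Suc N" "\<forall>\<beta>\<in>F. \<bar>f \<beta> n - \<kappa> \<beta> x\<bar> < \<epsilon>"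
    unfolding frequently_sequentially by blast
  then have "n \<in> nb x F \<epsilon> N" by (simp add: nb_def)
  then show ?thesis by blast
qed

lemma nb_Int: "nb x (F \<union> F') (min \<epsilon> \<epsilon>') (max N N') \<subseteq> nb x F \<epsilon> N \<inter> nb x F' \<epsilon>' N'"
  by (auto simp: nb_def)

definition eventually_at :: "'a \<Rightarrow> (nat \<Rightarrow> bool) \<Rightarrow> bool"
  where "eventually_at x P \<longleftrightarrow> (\<exists>F \<epsilon> N. finite F \<and> \<epsilon> > 0 \<and> (\<forall>n\<in>nb x F \<epsilon> N. P n))"

lemma eventually_atI: "finite F \<Longrightarrow> \<epsilon> > 0 \<Longrightarrow> (\<And>n. n \<in> nb x F \<epsilon> N \<Longrightarrow> P n) \<Longrightarrow> eventually_at x P"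
  unfolding eventually_at_def by blast

lemma eventually_at_conj:
  assumes "eventually_at x P" "eventually_at x Q" shows "eventually_at x (\<lambda>n. P n \<and> Q n)"
proof -
  obtain F \<epsilon> N where 1: "finite F" "\<epsilon> > 0" "\<forall>n\<in>nb x F \<epsilon> N. P n" using assms(1) by (auto simp: eventually_at_def)
  obtain F' \<epsilon>' N' where 2: "finite F'" "\<epsilon>' > 0" "\<forall>n\<in>nb x F' \<epsilon>' N'. Q n" using assms(2) by (auto simp: eventually_at_def)
  show ?thesis
  proof (rule eventually_atI)
    show "finite (F \<union> F')" "min \<epsilon> \<epsilon>' > 0" using 1 2 by auto
    show "P n \<and> Q n" if "n \<in> nb x (F \<union> F') (min \<epsilon> \<epsilon>') (max N N')" for n
      using nb_Int that 1(3) 2(3) by blast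
  qed
qed

lemma eventually_at_ball:
  assumes "finite G" "\<And>g. g \<in> G \<Longrightarrow> eventually_at x (P g)"
  shows "eventually_at x (\<lambda>n. \<forall>g\<in>G. P g n)"
  using assms
proof induction
  case empty then show ?case using eventually_atI[of "{}" 1] by simp
next
  case (insert g G)
  then show ?case using eventually_at_conj[of x "P g" "\<lambda>n. \<forall>g\<in>G. P g n"] by simp
qed

lemma eventually_at_ex:
  assumes "x \<in> topspace X" "eventually_at x P" shows "\<exists>n. P n"
  using assms nb_nonempty unfolding eventually_at_def by (meson ex_in_conv)

definition has_limit :: "(nat \<Rightarrow> real) \<Rightarrow> 'a \<Rightarrow> real \<Rightarrow> bool"
  where "has_limit \<phi> x c \<longleftrightarrow> (\<forall>\<delta>>0. eventually_at x (\<lambda>n. \<bar>\<phi> n - c\<bar> < \<delta>))"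

lemma has_limit_unique:
  assumes "x \<in> topspace X" "has_limit \<phi> x c" "has_limit \<phi> x d" shows "c = d"
proof (rule ccontr)
  assume "c \<noteq> d"
  then have "\<bar>c - d\<bar> / 2 > 0" by simp
  then have "eventually_at x (\<lambda>n. \<bar>\<phi> n - c\<bar> < \<bar>c - d\<bar> / 2)" "eventually_at x (\<lambda>n. \<bar>\<phi> n - d\<bar> < \<bar>c - d\<bar> / 2)"
    using assms(2,3) unfolding has_limit_def by blast+
  from eventually_at_ex[OF assms(1) eventually_at_conj[OF this]]
  obtain n where "\<bar>\<phi> n - c\<bar> < \<bar>c - d\<bar> / 2" "\<bar>\<phi> n - d\<bar> < \<bar>c - d\<bar> / 2" by blast
  then show False by argo
qed

lemma has_limit_exists:
  assumes x: "x \<in> topspace X" and \<phi>: "\<phi> \<in> SO" shows "\<exists>c. has_limit \<phi> x c"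
proof -
  have so: "slowly_oscillating UNIV coarse \<phi>" using \<phi> SO_iff by blast
  obtain M where M: "\<And>n. \<bar>\<phi> n\<bar> \<le> M"
    using \<phi> unfolding SO_iff bounded_iff by auto
  define S where "S = {b. eventually_at x (\<lambda>n. \<phi> n < b)}"
  have "\<phi> n < M + 1" for n using M[of n] by linarith
  then have "eventually_at x (\<lambda>n. \<phi> n < M + 1)"
    by (intro eventually_atI[of "{}" 1 x 0]) simp_all
  then have "M + 1 \<in> S" by (simp add: S_def)
  have lb: "-M \<le> b" if b: "b \<in> S" for b
  proof -
    have "\<exists>n. \<phi> n < b" by (rule eventually_at_ex[OF x]) (use b in \<open>simp add: S_def\<close>)
    then obtain n where "\<phi> n < b" by blast
    then show ?thesis using M[of n] by linarith
  qed
  then have bdd: "bdd_below S" by (rule bdd_belowI)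
  have "has_limit \<phi> x (Inf S)"
    unfolding has_limit_def
  proof (intro allI impI)
    fix \<delta> :: real assume "\<delta> > 0"
    \<comment> \<open>Eventual upper bounds at \<open>x\<close> come from the definition of \<open>S\<close>. For the lower bound, values above \<open>?c - \<delta>/2\<close> occur arbitrarily close to \<open>x\<close>, and values below \<open>?c - \<delta>\<close> are kept away from them.\<close>
    let ?c = "Inf S"
    have "\<exists>b\<in>S. b < ?c + \<delta>"
      using cInf_lessD[of S "?c + \<delta>"] \<open>M + 1 \<in> S\<close> \<open>\<delta> > 0\<close> by fastforce
    then obtain b where b: "eventually_at x (\<lambda>n. \<phi> n < b)" "b < ?c + \<delta>" unfolding S_def by blast
    have lt: "?c - \<delta> < ?c - \<delta>/2" using \<open>\<delta> > 0\<close> by simp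
    obtain F \<epsilon> N where F: "finite F" "\<epsilon> > 0"
      and sep: "\<forall>u v. \<phi> u \<le> ?c - \<delta> \<and> \<phi> v \<ge> ?c - \<delta>/2 \<and> u > N \<and> v > N \<longrightarrow> (\<exists>\<beta>\<in>F. \<bar>f \<beta> u - f \<beta> v\<bar> \<ge> \<epsilon>)"
      by (rule slowly_oscillating_separated[OF so lt])
    have "\<exists>v\<in>nb x F (\<epsilon>/2) N. \<phi> v \<ge> ?c - \<delta>/2"
    proof (rule ccontr)
      assume "\<not> ?thesis"
      then have "eventually_at x (\<lambda>n. \<phi> n < ?c - \<delta>/2)"
        using F by (intro eventually_atI[of F "\<epsilon>/2" x N]) auto
      then have "?c - \<delta>/2 \<in> S" by (simp add: S_def)
      then have "?c \<le> ?c - \<delta>/2" using bdd by (rule cInf_lower)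
      then show False using \<open>\<delta> > 0\<close> by simp
    qed
    then obtain v where v: "v \<in> nb x F (\<epsilon>/2) N" "\<phi> v \<ge> ?c - \<delta>/2" by blast
    have "\<phi> u > ?c - \<delta>" if u: "u \<in> nb x F (\<epsilon>/2) N" for u
    proof (rule ccontr)
      assume "\<not> ?thesis"
      then obtain \<beta> where \<beta>: "\<beta> \<in> F" "\<bar>f \<beta> u - f \<beta> v\<bar> \<ge> \<epsilon>"
        using sep[rule_format, of u v] u v by (auto simp: nb_def)
      have "\<bar>f \<beta> u - \<kappa> \<beta> x\<bar> < \<epsilon>/2" "\<bar>f \<beta> v - \<kappa> \<beta> x\<bar> < \<epsilon>/2" using u v \<beta>(1) by (auto simp: nb_def)
      then show False using \<beta>(2) by argo
    qed
    then have "eventually_at x (\<lambda>n. \<phi> n > ?c - \<delta>)"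
      using F by (intro eventually_atI[of F "\<epsilon>/2" x N]) auto
    from eventually_at_conj[OF b(1) this]
    show "eventually_at x (\<lambda>n. \<bar>\<phi> n - ?c\<bar> < \<delta>)"
      unfolding eventually_at_def using b(2) by (force simp: abs_less_iff)
  qed
  then show ?thesis by blast
qed

lemma has_limit_f: "has_limit (f \<beta>) x (\<kappa> \<beta> x)"
  unfolding has_limit_def
proof (intro allI impI)
  fix \<delta> :: real assume "\<delta> > 0"
  then show "eventually_at x (\<lambda>n. \<bar>f \<beta> n - \<kappa> \<beta> x\<bar> < \<delta>)"
    by (intro eventually_atI[of "{\<beta>}" \<delta> x 0]) (auto simp: nb_def)
qed

lemma has_limit_indicator: "has_limit (indicator {m}) x 0"
  unfolding has_limit_def
proof (intro allI impI)
  fix \<delta> :: real assume "\<delta> > 0"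
  then show "eventually_at x (\<lambda>n. \<bar>indicator {m} n - 0\<bar> < \<delta>)"
    by (intro eventually_atI[of "{}" 1 x m]) (auto simp: nb_def)
qed

section \<open>The homeomorphism onto the corona\<close>

definition \<Phi> :: "'a \<Rightarrow> (nat \<Rightarrow> real) \<Rightarrow> real"
  where "\<Phi> x = (\<lambda>\<phi>\<in>SO. THE c. has_limit \<phi> x c)"

lemma \<Phi>_eq:
  assumes "x \<in> topspace X" "\<phi> \<in> SO" "has_limit \<phi> x c" shows "\<Phi> x \<phi> = c"
  using assms has_limit_unique[OF assms(1)] by (auto simp: \<Phi>_def intro: the_equality)

lemma has_limit_\<Phi>:
  assumes "x \<in> topspace X" "\<phi> \<in> SO" shows "has_limit \<phi> x (\<Phi> x \<phi>)"
  using has_limit_exists[OF assms] \<Phi>_eq[OF assms] by metis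

abbreviation \<T> :: "((nat \<Rightarrow> real) \<Rightarrow> real) topology"
  where "\<T> \<equiv> product_topology (\<lambda>_. euclideanreal) SO"

abbreviation \<iota> :: "nat \<Rightarrow> (nat \<Rightarrow> real) \<Rightarrow> real" where "\<iota> \<equiv> higson_map UNIV coarse"

lemma \<iota>_in_topspace: "\<iota> n \<in> topspace \<T>"
  by (simp add: higson_map_def)

lemma \<iota>_apply: "\<phi> \<in> SO \<Longrightarrow> \<iota> n \<phi> = \<phi> n"
  by (simp add: higson_map_def)

lemma Hausdorff_\<T>: "Hausdorff_space \<T>"
  by (simp add: Hausdorff_space_product_topology)

lemma continuous_\<Phi>: "continuous_map X \<T> \<Phi>"
  unfolding continuous_map_componentwise
proof (intro conjI ballI)
  show "\<Phi> ` topspace X \<subseteq> extensional SO" by (auto simp: \<Phi>_def)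
  fix \<phi> assume \<phi>: "\<phi> \<in> SO"
  show "continuous_map X euclideanreal (\<lambda>x. \<Phi> x \<phi>)"
    unfolding continuous_map_eq_topcontinuous_at topcontinuous_at_def
  proof (intro ballI conjI allI impI)
    fix x V assume x: "x \<in> topspace X" and V: "openin euclideanreal V \<and> \<Phi> x \<phi> \<in> V"
    then obtain \<delta> where \<delta>: "\<delta> > 0" "ball (\<Phi> x \<phi>) \<delta> \<subseteq> V" by (auto simp: open_contains_ball)
    then have "eventually_at x (\<lambda>n. \<bar>\<phi> n - \<Phi> x \<phi>\<bar> < \<delta>/2)"
      using has_limit_\<Phi>[OF x \<phi>] unfolding has_limit_def by (meson half_gt_zero)
    then obtain F \<epsilon> N where F: "finite F" "\<epsilon> > 0" "\<forall>n\<in>nb x F \<epsilon> N. \<bar>\<phi> n - \<Phi> x \<phi>\<bar> < \<delta>/2"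
      unfolding eventually_at_def by (elim exE conjE)
    define U where "U = topspace X \<inter> (\<Inter>\<beta>\<in>F. {y \<in> topspace X. \<kappa> \<beta> y \<in> ball (\<kappa> \<beta> x) (\<epsilon>/2)})"
    have "openin X U"
    proof (cases "F = {}")
      case False
      have "openin X (\<Inter>\<beta>\<in>F. {y \<in> topspace X. \<kappa> \<beta> y \<in> ball (\<kappa> \<beta> x) (\<epsilon>/2)})"
        using F(1) False by (intro openin_INT2 openin_continuous_map_preimage[OF continuous]) auto
      then show ?thesis unfolding U_def by (intro openin_Int openin_topspace)
    qed (simp add: U_def)
    moreover have "x \<in> U" using x F(2) by (auto simp: U_def)
    moreover have "\<Phi> y \<phi> \<in> V" if "y \<in> U" for y
    proof -
      have y: "y \<in> topspace X" "\<And>\<beta>. \<beta> \<in> F \<Longrightarrow> \<bar>\<kappa> \<beta> x - \<kappa> \<beta> y\<bar> < \<epsilon>/2"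
        using that by (auto simp: U_def dist_real_def)
      have sub: "nb y F (\<epsilon>/2) N \<subseteq> nb x F \<epsilon> N"
      proof
        fix n assume n: "n \<in> nb y F (\<epsilon>/2) N"
        have "\<bar>f \<beta> n - \<kappa> \<beta> x\<bar> < \<epsilon>" if "\<beta> \<in> F" for \<beta>
        proof -
          have "\<bar>f \<beta> n - \<kappa> \<beta> y\<bar> < \<epsilon>/2" using n that by (auto simp: nb_def)
          then show ?thesis using y(2)[OF that] by argo
        qed
        then show "n \<in> nb x F \<epsilon> N" using n by (auto simp: nb_def)
      qed
      have "eventually_at y (\<lambda>n. \<bar>\<phi> n - \<Phi> x \<phi>\<bar> < \<delta>/2)"
        using F sub by (intro eventually_atI[of F "\<epsilon>/2" y N]) auto
      moreover have "eventually_at y (\<lambda>n. \<bar>\<phi> n - \<Phi> y \<phi>\<bar> < \<delta>/2)"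
        using has_limit_\<Phi>[OF y(1) \<phi>] \<delta>(1) unfolding has_limit_def by (meson half_gt_zero)
      ultimately obtain n where "\<bar>\<phi> n - \<Phi> x \<phi>\<bar> < \<delta>/2" "\<bar>\<phi> n - \<Phi> y \<phi>\<bar> < \<delta>/2"
        using eventually_at_ex[OF y(1) eventually_at_conj] by blast
      then have "\<Phi> y \<phi> \<in> ball (\<Phi> x \<phi>) \<delta>" unfolding mem_ball dist_real_def by argo
      then show ?thesis using \<delta>(2) by blast
    qed
    ultimately show "\<exists>U. openin X U \<and> x \<in> U \<and> (\<forall>y\<in>U. \<Phi> y \<phi> \<in> V)" by blast
  qed auto
qed

lemma inj_on_\<Phi>: "inj_on \<Phi> (topspace X)"
proof (rule inj_onI, rule ccontr)
  fix x y assume *: "x \<in> topspace X" "y \<in> topspace X" "\<Phi> x = \<Phi> y" "x \<noteq> y"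
  then obtain \<beta> where "\<kappa> \<beta> x \<noteq> \<kappa> \<beta> y" using separating by blast
  moreover have "\<Phi> x (f \<beta>) = \<kappa> \<beta> x" "\<Phi> y (f \<beta>) = \<kappa> \<beta> y"
    using * \<Phi>_eq f_in_SO has_limit_f by blast+
  ultimately show False using *(3) by simp
qed

lemma \<Phi>_in_closure:
  assumes x: "x \<in> topspace X" shows "\<Phi> x \<in> \<T> closure_of range \<iota>"
  unfolding in_closure_of
proof (intro conjI allI impI)
  show "\<Phi> x \<in> topspace \<T>" 
    using continuous_map_image_subset_topspace[OF continuous_\<Phi>] x by blast
  fix T assume "\<Phi> x \<in> T \<and> openin \<T> T"
  then have "\<Phi> x \<in> T" and T: "openin \<T> T" by blast+
  from T[unfolded openin_product_topology_alt, rule_format, OF this(1)]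
  obtain U where U: "finite {\<phi> \<in> SO. U \<phi> \<noteq> topspace euclideanreal}"
    "\<forall>\<phi>\<in>SO. openin euclideanreal (U \<phi>)" "\<Phi> x \<in> PiE SO U" "PiE SO U \<subseteq> T"
    by (elim exE conjE) (rule that; blast)
  let ?G = "{\<phi> \<in> SO. U \<phi> \<noteq> topspace euclideanreal}"
  have ev: "eventually_at x (\<lambda>n. \<phi> n \<in> U \<phi>)" if "\<phi> \<in> ?G" for \<phi>
  proof -
    have \<phi>: "\<phi> \<in> SO" using that by blast
    then have "open (U \<phi>)" "\<Phi> x \<phi> \<in> U \<phi>" using U(2,3) by (auto dest: PiE_mem)
    then obtain \<delta> where \<delta>: "\<delta> > 0" "ball (\<Phi> x \<phi>) \<delta> \<subseteq> U \<phi>" by (auto simp: open_contains_ball)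
    then have "eventually_at x (\<lambda>n. \<bar>\<phi> n - \<Phi> x \<phi>\<bar> < \<delta>)"
      using has_limit_\<Phi>[OF x \<phi>] unfolding has_limit_def by blast
    moreover have "\<phi> n \<in> U \<phi>" if "\<bar>\<phi> n - \<Phi> x \<phi>\<bar> < \<delta>" for n
      using that \<delta>(2) by (auto simp: dist_real_def abs_minus_commute)
    ultimately show ?thesis unfolding eventually_at_def by meson
  qed
  have "eventually_at x (\<lambda>n. \<forall>\<phi>\<in>?G. \<phi> n \<in> U \<phi>)"
    by (rule eventually_at_ball[OF U(1)]) (rule ev)
  from eventually_at_ex[OF x this] obtain n where n: "\<forall>\<phi>\<in>?G. \<phi> n \<in> U \<phi>" by (elim exE)
  have "\<iota> n \<in> PiE SO U"
    using n by (auto simp: higson_map_def)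
  then show "\<exists>y. y \<in> range \<iota> \<and> y \<in> T" using U(4) by blast
qed

lemma \<Phi>_not_\<iota>:
  assumes x: "x \<in> topspace X" shows "\<Phi> x \<noteq> \<iota> m"
proof
  assume "\<Phi> x = \<iota> m"
  moreover have "\<Phi> x (indicator {m}) = 0"
    using x indicator_in_SO has_limit_indicator by (rule \<Phi>_eq)
  moreover have "\<iota> m (indicator {m}) = 1" using indicator_in_SO by (simp add: \<iota>_apply)
  ultimately show False by simp
qed

text \<open>Removing the finitely many points up to \<open>N\<close> from a neighbourhood of \<open>z\<close> leaves a neighbourhood of \<open>z\<close>.\<close>

lemma approximate_corona_point:
  assumes z: "z \<in> \<T> closure_of range \<iota>" "z \<notin> range \<iota>"
    and G: "finite G" "G \<subseteq> SO" and "\<delta> > 0"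
  shows "\<exists>n>N. \<forall>\<phi>\<in>G. \<bar>\<phi> n - z \<phi>\<bar> < \<delta>"
proof -
  define U where "U \<phi> = (if \<phi> \<in> G then ball (z \<phi>) \<delta> else UNIV)" for \<phi>
  have zt: "z \<in> topspace \<T>" using z(1) by (simp add: in_closure_of)
  have "openin \<T> (PiE SO U)"
  proof -
    have "{\<phi> \<in> SO. U \<phi> \<noteq> topspace euclideanreal} \<subseteq> G" by (auto simp: U_def)
    then have "finite {\<phi> \<in> SO. U \<phi> \<noteq> topspace euclideanreal}" using G(1) finite_subset by blast
    then show ?thesis unfolding openin_PiE_gen by (auto simp: U_def)
  qed
  moreover have "closedin \<T> (\<iota> ` {..N})"
    using Hausdorff_\<T> \<iota>_in_topspace by (intro closedin_Hausdorff_finite) auto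
  ultimately have op: "openin \<T> (PiE SO U - \<iota> ` {..N})" by (rule openin_diff)
  have "z \<in> PiE SO U"
    using zt \<open>\<delta> > 0\<close> by (auto simp: U_def PiE_iff)
  then have "z \<in> PiE SO U - \<iota> ` {..N}" using z(2) by blast
  with z(1) op have "\<exists>y. y \<in> range \<iota> \<and> y \<in> PiE SO U - \<iota> ` {..N}"
    unfolding in_closure_of by (elim conjE allE[of _ "PiE SO U - \<iota> ` {..N}"]) (rule mp, assumption, rule conjI)
  then obtain n where n: "\<iota> n \<in> PiE SO U - \<iota> ` {..N}" by (elim exE conjE rangeE) simp
  have "n \<notin> {..N}" using n by blast
  then have "n > N" by simp
  moreover have "\<bar>\<phi> n - z \<phi>\<bar> < \<delta>" if "\<phi> \<in> G" for \<phi>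
  proof -
    have "\<iota> n \<phi> \<in> U \<phi>" using n that G(2) by (auto dest: PiE_mem)
    then show ?thesis using that G(2) \<iota>_apply[of \<phi> n] by (auto simp: U_def dist_real_def abs_minus_commute)
  qed
  ultimately show ?thesis by blast
qed

text \<open>The values of \<open>z\<close> at the coordinates \<open>f \<beta>\<close> are approximated, finitely many at a time, by values \<open>f \<beta> n\<close>
  with large \<open>n\<close>, and these by points of the compact space.  Compactness gives a point \<open>x\<close> with
  \<open>\<kappa> \<beta> x = z (f \<beta>)\<close> for all \<open>\<beta>\<close>.  Integers \<open>n\<close> close to \<open>z\<close> are then close to \<open>x\<close>, so \<open>z\<close> and \<open>\<Phi> x\<close>
  agree at every coordinate.\<close>

lemma corona_point_in_range_\<Phi>:
  assumes z: "z \<in> \<T> closure_of range \<iota>" "z \<notin> range \<iota>"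
  shows "z \<in> \<Phi> ` topspace X"
proof -
  define C where "C b = {x \<in> topspace X. \<kappa> (fst b) x \<in> cball (z (f (fst b))) (inverse (real (Suc (snd b))))}" for b :: "'i \<times> nat"
  have "closedin X (C b)" for b
    unfolding C_def by (intro closedin_continuous_map_preimage[OF continuous]) simp
  moreover have "\<Inter>\<F> \<noteq> {}" if \<F>: "finite \<F>" "\<F> \<subseteq> range C" for \<F>
  proof -
    obtain S where S: "finite S" "\<F> = C ` S" using finite_subset_image[OF \<F>] by blast
    obtain M where M: "\<And>k. k \<in> snd ` S \<Longrightarrow> k < M"
      using S(1) finite_nat_set_iff_bounded by (meson finite_imageI)
    let ?F = "fst ` S" and ?d = "inverse (real (Suc M)) / 2"
    have d: "?d > 0" by simp
    have "eventually (\<lambda>n. \<exists>x\<in>topspace X. \<forall>\<beta>\<in>?F. \<bar>f \<beta> n - \<kappa> \<beta> x\<bar> < ?d) sequentially"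
      by (rule near_admissible[OF _ admissible d]) (use S(1) in simp)
    then obtain N where N: "\<And>n. n \<ge> N \<Longrightarrow> \<exists>x\<in>topspace X. \<forall>\<beta>\<in>?F. \<bar>f \<beta> n - \<kappa> \<beta> x\<bar> < ?d"
      unfolding eventually_sequentially by blast
    have "finite (f ` ?F)" "f ` ?F \<subseteq> SO" using S(1) f_in_SO by auto
    from approximate_corona_point[OF z this d, of N]
    obtain n where n: "n > N" "\<forall>\<phi>\<in>f ` ?F. \<bar>\<phi> n - z \<phi>\<bar> < ?d" by blast
    obtain x where x: "x \<in> topspace X" "\<forall>\<beta>\<in>?F. \<bar>f \<beta> n - \<kappa> \<beta> x\<bar> < ?d" using N[of n] n(1) by auto
    have "x \<in> C b" if "b \<in> S" for b
    proof -
      have b: "fst b \<in> ?F" "snd b < M" using that M by auto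
      have "\<bar>f (fst b) n - \<kappa> (fst b) x\<bar> < ?d" "\<bar>f (fst b) n - z (f (fst b))\<bar> < ?d"
        using b(1) x(2) n(2) by blast+
      then have "\<bar>z (f (fst b)) - \<kappa> (fst b) x\<bar> < inverse (real (Suc M))" by argo
      also have "\<dots> \<le> inverse (real (Suc (snd b)))" using b(2) by (simp add: field_simps)
      finally show ?thesis using x(1) unfolding C_def mem_Collect_eq mem_cball dist_real_def by simp
    qed
    then have "x \<in> \<Inter>\<F>" using S(2) by blast
    then show ?thesis by blast
  qed
  ultimately have "\<Inter>(range C) \<noteq> {}"
    using compact unfolding compact_space_fip by (metis (no_types, lifting) imageE)
  then obtain x where x: "\<And>b. x \<in> C b" by blast
  have xX: "x \<in> topspace X" using x[of undefined] by (simp add: C_def)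
  have zx: "\<kappa> \<beta> x = z (f \<beta>)" for \<beta>
  proof (rule ccontr)
    assume "\<kappa> \<beta> x \<noteq> z (f \<beta>)"
    then obtain k where "inverse (real (Suc k)) < \<bar>z (f \<beta>) - \<kappa> \<beta> x\<bar>"
      using reals_Archimedean[of "\<bar>z (f \<beta>) - \<kappa> \<beta> x\<bar>"] by auto
    then show False using x[of "(\<beta>, k)"] by (simp add: C_def dist_real_def)
  qed
  have "z \<phi> = \<Phi> x \<phi>" for \<phi>
  proof (cases "\<phi> \<in> SO")
    case True
    show ?thesis
    proof (rule ccontr)
      assume "z \<phi> \<noteq> \<Phi> x \<phi>"
      then have \<delta>: "\<bar>z \<phi> - \<Phi> x \<phi>\<bar> / 2 > 0" (is "?\<delta> > 0") by simp
      then obtain F \<epsilon> N where F: "finite F" "\<epsilon> > 0" "\<forall>n\<in>nb x F \<epsilon> N. \<bar>\<phi> n - \<Phi> x \<phi>\<bar> < ?\<delta>"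
        using has_limit_\<Phi>[OF xX True] unfolding has_limit_def eventually_at_def by meson
      have "finite (insert \<phi> (f ` F))" "insert \<phi> (f ` F) \<subseteq> SO" "min ?\<delta> \<epsilon> > 0"
        using F \<delta> True f_in_SO by auto
      from approximate_corona_point[OF z this, of N]
      obtain n where n: "n > N" "\<forall>\<psi>\<in>insert \<phi> (f ` F). \<bar>\<psi> n - z \<psi>\<bar> < min ?\<delta> \<epsilon>" by blast
      then have "n \<in> nb x F \<epsilon> N" by (auto simp: nb_def zx)
      then have "\<bar>\<phi> n - \<Phi> x \<phi>\<bar> < ?\<delta>" using F(3) by blast
      moreover have "\<bar>\<phi> n - z \<phi>\<bar> < ?\<delta>" using n(2) by simp
      ultimately show False by argo
    qed
  next
    case False
    have "z \<in> extensional SO" using z(1) by (auto simp: in_closure_of PiE_iff)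
    then show ?thesis using False by (simp add: \<Phi>_def extensional_def)
  qed
  then show ?thesis using xX by (intro image_eqI[of _ _ x]) auto
qed

lemma homeomorphic_corona: "X homeomorphic_space higson_corona UNIV coarse"
proof -
  let ?Cl = "\<T> closure_of range \<iota>"
  let ?H = "higson_compactification UNIV coarse"
  have H: "?H = subtopology \<T> ?Cl"
    by (simp only: higson_compactification_def Let_def)
  have topH: "topspace ?H = ?Cl"
    unfolding H by (simp add: closure_of_subset_topspace inf.absorb2 del: topspace_product_topology)
  have HH: "Hausdorff_space ?H" unfolding H by (rule Hausdorff_space_subtopology[OF Hausdorff_\<T>])
  have \<iota>H: "range \<iota> \<subseteq> topspace ?H"
    unfolding topH using \<iota>_in_topspace by (intro closure_of_subset) blast
  have closed: "?H closure_of (\<iota> ` S) = \<iota> ` S" if "finite S" for S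
    using that HH \<iota>H by (intro closure_of_closedin closedin_Hausdorff_finite) auto
  have "\<Union>{?H closure_of (\<iota> ` S) | S. coarsely_bounded UNIV coarse S} = range \<iota>"
  proof (intro equalityI subsetI)
    fix y assume "y \<in> \<Union>{?H closure_of (\<iota> ` S) | S. coarsely_bounded UNIV coarse S}"
    then obtain S where "finite S" "y \<in> ?H closure_of (\<iota> ` S)"
      unfolding coarsely_bounded_iff by blast
    then show "y \<in> range \<iota>" using closed[of S] by auto
  next
    fix y assume "y \<in> range \<iota>"
    then obtain n where "y = \<iota> n" by blast
    then have "y \<in> ?H closure_of (\<iota> ` {n})" using closed[of "{n}"] by simp
    moreover have "coarsely_bounded UNIV coarse {n}" by (simp add: coarsely_bounded_iff)
    ultimately show "y \<in> \<Union>{?H closure_of (\<iota> ` S) | S. coarsely_bounded UNIV coarse S}"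
      by (intro UnionI[of "?H closure_of (\<iota> ` {n})"] CollectI exI[of _ "{n}"] conjI refl)
  qed
  then have corona: "higson_corona UNIV coarse = subtopology ?H (?Cl - range \<iota>)"
    by (simp only: higson_corona_def Let_def topH)
  have eq: "\<Phi> ` topspace X = ?Cl - range \<iota>"
  proof (intro equalityI subsetI)
    fix z assume "z \<in> \<Phi> ` topspace X"
    then obtain x where x: "x \<in> topspace X" "z = \<Phi> x" by blast
    then have "z \<in> ?Cl" using \<Phi>_in_closure by simp
    moreover have "z \<notin> range \<iota>" using \<Phi>_not_\<iota>[OF x(1)] x(2) by auto
    ultimately show "z \<in> ?Cl - range \<iota>" by (rule DiffI)
  qed (elim DiffE, rule corona_point_in_range_\<Phi>)
  have "homeomorphic_map X (higson_corona UNIV coarse) \<Phi>"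
  proof (rule continuous_imp_homeomorphic_map)
    show "continuous_map X (higson_corona UNIV coarse) \<Phi>"
      unfolding corona H using eq
      by (intro continuous_map_into_subtopology continuous_\<Phi>) blast+
    show "Hausdorff_space (higson_corona UNIV coarse)"
      unfolding corona by (rule Hausdorff_space_subtopology[OF HH])
    show "\<Phi> ` topspace X = topspace (higson_corona UNIV coarse)"
      unfolding corona eq using topH by auto
  qed (use compact inj_on_\<Phi> in auto)
  then show ?thesis by (rule homeomorphic_map_imp_homeomorphic_space)
qed

end

section \<open>Indexing by the countable ordinals\<close>

lemma continuum_nat_sets:
  assumes continuum_hypothesis shows "|UNIV :: nat set set| =o omega1"
  using nat_sets_eqpoll_reals assms ordIso_transitive
  unfolding continuum_hypothesis_def eqpoll_iff_card_of_ordIso by blast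

text \<open>The type of pairs of sets of natural numbers serves as index set: a pair directly encodes the two sets to be
  treated at its stage, and by the Continuum Hypothesis it is well-ordered in type \<open>\<omega>\<^sub>1\<close>.\<close>

lemma omega1_well_order:
  assumes continuum_hypothesis
  obtains R :: "(nat set \<times> nat set) rel" where "wf R" "trans R"
    "\<forall>x y. x = y \<or> (x,y) \<in> R \<or> (y,x) \<in> R" "\<forall>\<alpha>. countable {\<beta>. (\<beta>,\<alpha>) \<in> R}"
proof -
  let ?I = "UNIV :: (nat set \<times> nat set) set"
  let ?r = "|?I|"
  have "infinite (UNIV :: nat set set)" by (simp add: Finite_Set.finite_set)
  then have "|UNIV \<times> UNIV :: (nat set \<times> nat set) set| =o |UNIV :: nat set set|"
    by (rule card_of_Times_same_infinite)
  then have "?r =o |UNIV :: nat set set|" by simp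
  then have r: "?r =o omega1" using continuum_nat_sets[OF assms] by (rule ordIso_transitive)
  have wo: "well_order_on ?I ?r" by (rule card_of_well_order_on)
  then have lin: "linear_order_on ?I ?r" and wf: "wf (?r - Id)" by (simp_all add: well_order_on_def)
  have tr: "trans ?r" and an: "antisym ?r" and tot: "total_on ?I ?r"
    using lin by (simp_all add: order_on_defs)
  show ?thesis
  proof
    show "wf (?r - Id)" by (rule wf)
    show "trans (?r - Id)" by (rule trans_diff_Id[OF tr an])
    show "\<forall>x y. x = y \<or> (x,y) \<in> ?r - Id \<or> (y,x) \<in> ?r - Id" 
      using tot unfolding total_on_def by blast
    show "\<forall>\<alpha>. countable {\<beta>. (\<beta>,\<alpha>) \<in> ?r - Id}"
    proof
      fix \<alpha>
      have "|underS ?r \<alpha>| <o ?r"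
        by (rule card_of_underS[OF card_of_Card_order]) (simp add: Field_card_of)
      then have "|underS ?r \<alpha>| <o omega1" using r by (rule ordLess_ordIso_trans)
      then have "|underS ?r \<alpha>| \<le>o natLeq"
        using cardSuc_ordLeq_ordLess[OF natLeq_Card_order card_of_Card_order] by blast
      then have "countable (underS ?r \<alpha>)" by (simp add: countable_card_le_natLeq)
      moreover have "underS ?r \<alpha> = {\<beta>. (\<beta>,\<alpha>) \<in> ?r - Id}" by (auto simp: underS_def)
      ultimately show "countable {\<beta>. (\<beta>,\<alpha>) \<in> ?r - Id}" by simp
    qed
  qed
qed

text \<open>Urysohn functions for the pairs \<open>(U,V)\<close> of basic sets such that the closure of \<open>U\<close> lies in \<open>V\<close>.  The
  family is indexed by pairs of codes of basic sets; at an index that codes no such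
  pair, any continuous function will do.\<close>

lemma separating_family:
  fixes X :: "'a topology"
  assumes "compact_space X" "Hausdorff_space X" and base: "is_base X \<B>"
    and "|\<B>| \<le>o |UNIV :: 'c set|"
  obtains \<kappa> :: "'c \<times> 'c \<Rightarrow> 'a \<Rightarrow> real" where
    "\<forall>\<alpha>. continuous_map X (top_of_set {0..1}) (\<kappa> \<alpha>)"
    "\<forall>x\<in>topspace X. \<forall>y\<in>topspace X. x \<noteq> y \<longrightarrow> (\<exists>\<alpha>. \<kappa> \<alpha> x \<noteq> \<kappa> \<alpha> y)"
proof -
  obtain j :: "'a set \<Rightarrow> 'c" where j: "inj_on j \<B>"
    using assms(4) card_of_ordLeq[of \<B> "UNIV :: 'c set"] by auto
  have normal: "normal_space X" and regular: "regular_space X"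
    using assms(1,2) compact_Hausdorff_or_regular_imp_normal_space compact_Hausdorff_imp_regular_space
    by blast+
  have "\<exists>h. continuous_map X (top_of_set {0..1::real}) h \<and>
    (\<forall>U\<in>\<B>. \<forall>V\<in>\<B>. j U = fst \<alpha> \<and> j V = snd \<alpha> \<and> X closure_of U \<subseteq> V \<longrightarrow>
      h ` U \<subseteq> {0} \<and> h ` (topspace X - V) \<subseteq> {1})" for \<alpha> :: "'c \<times> 'c"
  proof (cases "\<exists>U\<in>\<B>. \<exists>V\<in>\<B>. j U = fst \<alpha> \<and> j V = snd \<alpha> \<and> X closure_of U \<subseteq> V")
    case True
    then obtain U V where UV: "U \<in> \<B>" "V \<in> \<B>" "j U = fst \<alpha>" "j V = snd \<alpha>" "X closure_of U \<subseteq> V" by blast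
    have op: "openin X U" "openin X V" using base UV unfolding is_base_def by blast+
    have cl: "closedin X (X closure_of U)" "closedin X (topspace X - V)" using op by auto
    have "disjnt (X closure_of U) (topspace X - V)" using UV(5) by (auto simp: disjnt_def)
    then obtain h where h: "continuous_map X (top_of_set {0..1::real}) h"
      "h ` (X closure_of U) \<subseteq> {0}" "h ` (topspace X - V) \<subseteq> {1}"
      using Urysohn_lemma[OF normal cl, of 0 1] by auto
    have "U \<subseteq> X closure_of U" using op(1) by (intro closure_of_subset openin_subset)
    then have "h ` U \<subseteq> {0}" using h(2) by blast
    show ?thesis
    proof (intro exI[of _ h] conjI ballI impI)
      fix U' V' assume *: "U' \<in> \<B>" "V' \<in> \<B>" "j U' = fst \<alpha> \<and> j V' = snd \<alpha> \<and> X closure_of U' \<subseteq> V'"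
      then have "U' = U" "V' = V" using inj_onD[OF j] UV(1-4) by simp_all
      then show "h ` U' \<subseteq> {0}" "h ` (topspace X - V') \<subseteq> {1}"
        using h(3) \<open>h ` U \<subseteq> {0}\<close> by simp_all
    qed (rule h(1))
  next
    case False
    have "continuous_map X (top_of_set {0..1::real}) (\<lambda>_. 0)" by simp
    then show ?thesis using False by blast
  qed
  then have "\<exists>\<kappa>. \<forall>\<alpha>. continuous_map X (top_of_set {0..1::real}) (\<kappa> \<alpha>) \<and>
    (\<forall>U\<in>\<B>. \<forall>V\<in>\<B>. j U = fst \<alpha> \<and> j V = snd \<alpha> \<and> X closure_of U \<subseteq> V \<longrightarrow>
      \<kappa> \<alpha> ` U \<subseteq> {0} \<and> \<kappa> \<alpha> ` (topspace X - V) \<subseteq> {1})" by (intro choice allI)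
  then obtain \<kappa> where *: "\<forall>\<alpha>. continuous_map X (top_of_set {0..1::real}) (\<kappa> \<alpha>) \<and>
    (\<forall>U\<in>\<B>. \<forall>V\<in>\<B>. j U = fst \<alpha> \<and> j V = snd \<alpha> \<and> X closure_of U \<subseteq> V \<longrightarrow>
      \<kappa> \<alpha> ` U \<subseteq> {0} \<and> \<kappa> \<alpha> ` (topspace X - V) \<subseteq> {1})" by (elim exE)
  then have cont: "\<forall>\<alpha>. continuous_map X (top_of_set {0..1}) (\<kappa> \<alpha>)" by blast
  have "\<exists>\<alpha>. \<kappa> \<alpha> x \<noteq> \<kappa> \<alpha> y" if x: "x \<in> topspace X" and y: "y \<in> topspace X" and "x \<noteq> y" for x y
  proof -
    have "closedin X {y}" using closedin_Hausdorff_sing_eq[OF assms(2)] y by blast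
    then have "openin X (topspace X - {y})" by blast
    moreover have "x \<in> topspace X - {y}" using x \<open>x \<noteq> y\<close> by blast
    ultimately obtain V where V: "V \<in> \<B>" "x \<in> V" "V \<subseteq> topspace X - {y}"
      using base unfolding is_base_def by meson
    have "openin X V" using base V(1) by (simp add: is_base_def)
    then have "closedin X (topspace X - V)" "x \<in> topspace X - (topspace X - V)" using x V(2) by auto
    then obtain U' where U': "openin X U'" "x \<in> U'" "disjnt (topspace X - V) (X closure_of U')"
      using regular unfolding regular_space by meson
    then obtain U where U: "U \<in> \<B>" "x \<in> U" "U \<subseteq> U'" using base unfolding is_base_def by meson
    have "X closure_of U \<subseteq> V"
      using U'(3) closure_of_mono[OF U(3), of X] closure_of_subset_topspace[of X U'] unfolding disjnt_def by blast
    with *[rule_format, THEN conjunct2, rule_format, OF U(1) V(1), of "(j U, j V)"]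
    have "\<kappa> (j U, j V) ` U \<subseteq> {0}" "\<kappa> (j U, j V) ` (topspace X - V) \<subseteq> {1}" by simp_all
    then have "\<kappa> (j U, j V) x = 0" "\<kappa> (j U, j V) y = 1" using U(2) V(3) y by blast+
    then show ?thesis by (intro exI[of _ "(j U, j V)"]) simp
  qed
  then have "\<forall>x\<in>topspace X. \<forall>y\<in>topspace X. x \<noteq> y \<longrightarrow> (\<exists>\<alpha>. \<kappa> \<alpha> x \<noteq> \<kappa> \<alpha> y)" by blast
  with cont show ?thesis by (rule that)
qed

theorem corollary9p9:
  fixes K :: "'a topology"
  assumes "continuum_hypothesis"
    and "compact_space K" and "Hausdorff_space K" and "topspace K \<noteq> {}"
    and "weight K \<le>o omega1"
  shows "\<exists>(X :: nat set) \<E>.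
    coarse_space X \<E> \<and> cellular X \<E> \<and> finitary X \<E> \<and> |X| =o natLeq \<and>
    K homeomorphic_space higson_corona X \<E>"
proof -
  obtain R :: "(nat set \<times> nat set) rel" where R: "wf R" "trans R"
    "\<forall>x y. x = y \<or> (x,y) \<in> R \<or> (y,x) \<in> R" "\<forall>\<alpha>. countable {\<beta>. (\<beta>,\<alpha>) \<in> R}"
    by (rule omega1_well_order[OF assms(1)])
  obtain \<B> where \<B>: "is_base K \<B>" "|\<B>| \<le>o omega1"
    using assms(5) unfolding weight_ordLeq_iff by blast
  have "|\<B>| \<le>o |UNIV :: nat set set|"
    using \<B>(2) ordIso_symmetric[OF continuum_nat_sets[OF assms(1)]] by (rule ordLeq_ordIso_trans)
  then obtain \<kappa> :: "nat set \<times> nat set \<Rightarrow> 'a \<Rightarrow> real" where cont: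
    "\<forall>\<alpha>. continuous_map K (top_of_set {0..1}) (\<kappa> \<alpha>)"
    and sep: "\<forall>x\<in>topspace K. \<forall>y\<in>topspace K. x \<noteq> y \<longrightarrow> (\<exists>\<alpha>. \<kappa> \<alpha> x \<noteq> \<kappa> \<alpha> y)"
    by (rule separating_family[OF assms(2,3) \<B>(1)])
  have range: "\<kappa> \<alpha> x \<in> {0..1}" if "x \<in> topspace K" for \<alpha> x
    using continuous_map_image_subset_topspace[OF cont[rule_format]] that by fastforce
  interpret omega1_recursion R "topspace K" \<kappa> fst snd
  proof
    show "x = y \<or> (x,y) \<in> R \<or> (y,x) \<in> R" for x y using R(3) by blast
    show "countable {\<beta>. (\<beta>,\<alpha>) \<in> R}" for \<alpha> using R(4) by (rule spec)
  qed (rule R(1) R(2) assms(4) range, assumption?)+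
  obtain f E where admissible: "\<forall>\<alpha>. admissible f E \<alpha>" using all_admissible by blast
  interpret corona_construction R K \<kappa> fst snd f E
  proof
    show "continuous_map K euclideanreal (\<kappa> \<alpha>)" for \<alpha>
      by (rule continuous_map_into_fulltopology[OF cont[rule_format]])
    show "\<exists>\<alpha>. fst \<alpha> = S \<and> snd \<alpha> = T" for S T :: "nat set"
      by (intro exI[of _ "(S, T)"]) simp
  qed (use sep assms(2) admissible in blast)+
  show ?thesis
    using coarse_space_coarse cellular_coarse finitary_coarse card_of_nat homeomorphic_corona by blast
qed

end
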